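(* Let $\mathcal{M}_2$ be a general rotational surface of hyperbolic type in $\mathbb{E}^4_2$ with plane meridian curve $m$, i.e. the Lorentz surface $$z(u,v)=\left(f(u)\cosh\alpha v,\ g(u)\cosh\beta v,\ f(u)\sinh\alpha v,\ g(u)\sinh\beta v\right),\quad u\in J,\ v\in[0,2\pi),$$ where $\alpha,\beta$ are positive constants and $f,g$ are smooth functions on $J$ with $\alpha^2f^2+\beta^2g^2>0$ and $f'^2+g'^2>0$. Assume that $\mathcal{M}_2$ contains no open part of a plane. Then $\mathcal{M}_2$ is minimal if and only if the meridian curve $m$ (i.e. the pair $f,g$) is determined by one of the following: (i) $f=c\,g^{\mp\frac{\alpha}{\beta}}$ (for one of the two signs), where $c=const$, $c\neq0$, and $\alpha\neq\beta$; (ii) $\alpha f+\sqrt{\alpha^2f^2-A}=C\left(\beta g+\sqrt{\beta^2g^2+A}\right)^{\pm\frac{\alpha}{\beta}}$ (for one of the two signs), where $C=const$, $A=const$, $AC\neq0$, and $\alpha\neq\beta$; (iii) $\arctan\left(\frac{f'}{g'}\right)=-\arctan\left(\frac{f}{g}\right)+c$, where $c=const$, and $\alpha=\beta$.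
   Context: $\mathbb{E}^4_2$ is $\mathbb{R}^4$ with the metric $dx_1^2+dx_2^2-dx_3^2-dx_4^2$. $J\subset\mathbb{R}$ is an interval. The meridian curve $m$ is the plane curve $u\mapsto(f(u),g(u),0,0)$. A surface in $\mathbb{E}^4_2$ is Lorentz if its induced metric has signature $(1,1)$; here the first fundamental form is $E=f'^2+g'^2>0$, $F=0$, $G=-(\alpha^2f^2+\beta^2g^2)<0$. With $\sigma$ the second fundamental form, the mean curvature vector field is $H=\frac12\operatorname{tr}\sigma=\frac12(\sigma(x,x)-\sigma(y,y))$ for an orthonormal tangent frame with $\langle x,x\rangle=1$, $\langle y,y\rangle=-1$. The surface is minimal if $H=0$ identically.
   Formalization: Since (ii), (iii) can fail globally, they are required on each interval of J minus finitely many points (zeros of the radicands in (ii); of g or g' in (iii)), with C, sign, c depending on the interval; powers in (i), (ii) use the absolute value of the base. *)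

theory Defs
  imports "HOL-Analysis.Analysis"
begin

section \<open>Calculus on an interval that may contain endpoints\<close>

definition deriv_on :: "real set \<Rightarrow> (real \<Rightarrow> 'a::real_normed_vector) \<Rightarrow> real \<Rightarrow> 'a" where
  "deriv_on S h t = vector_derivative h (at t within S)"

definition smooth_on :: "real set \<Rightarrow> (real \<Rightarrow> 'a::real_normed_vector) \<Rightarrow> bool" where
  "smooth_on S h \<longleftrightarrow> (\<forall>n. ((deriv_on S ^^ n) h) differentiable_on S)"

section \<open>Parametrized surfaces in the neutral space \<open>E\<^sup>4\<^sub>2\<close>\<close>

definition neutral_inner :: "real^4 \<Rightarrow> real^4 \<Rightarrow> real" where
  "neutral_inner x y = x$1 * y$1 + x$2 * y$2 - x$3 * y$3 - x$4 * y$4"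

text \<open>
  A parametrized surface is a map \<open>z u v\<close> with \<open>u\<close> ranging over \<open>J\<close> and \<open>v\<close> over \<open>V\<close>;
  all derivatives are taken within these sets.
\<close>

definition partial_u :: "real set \<Rightarrow> (real \<Rightarrow> real \<Rightarrow> real^4) \<Rightarrow> real \<Rightarrow> real \<Rightarrow> real^4" where
  "partial_u J z u v = deriv_on J (\<lambda>s. z s v) u"

definition partial_v :: "real set \<Rightarrow> (real \<Rightarrow> real \<Rightarrow> real^4) \<Rightarrow> real \<Rightarrow> real \<Rightarrow> real^4" where
  "partial_v V z u v = deriv_on V (\<lambda>t. z u t) v"

text \<open>
  A tangent vector at \<open>z u v\<close> is given by its coordinates \<open>(a\<^sub>1, a\<^sub>2)\<close> with respect to
  \<open>z\<^sub>u, z\<^sub>v\<close>; \<open>tangent_vec\<close> is the corresponding vector of the ambient space.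
\<close>

definition tangent_vec ::
  "real set \<Rightarrow> real set \<Rightarrow> (real \<Rightarrow> real \<Rightarrow> real^4) \<Rightarrow> real \<Rightarrow> real \<Rightarrow> real \<times> real \<Rightarrow> real^4" where
  "tangent_vec J V z u v a = fst a *\<^sub>R partial_u J z u v + snd a *\<^sub>R partial_v V z u v"

text \<open>
  The component of \<open>w\<close> orthogonal to the subspace \<open>T\<close>. It is well defined when the neutral
  metric is nondegenerate on \<open>T\<close>, in particular when \<open>T\<close> is a Lorentz plane.
\<close>

definition normal_part :: "(real^4) set \<Rightarrow> real^4 \<Rightarrow> real^4" where
  "normal_part T w = (THE n. w - n \<in> T \<and> (\<forall>t\<in>T. neutral_inner n t = 0))"

text \<open>
  The ambient connection is the flat one, so \<open>\<sigma>(z\<^sub>i, z\<^sub>j)\<close> is the normal part of \<open>z\<^sub>i\<^sub>j\<close>.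
\<close>

definition second_fundamental_form ::
  "real set \<Rightarrow> real set \<Rightarrow> (real \<Rightarrow> real \<Rightarrow> real^4) \<Rightarrow> real \<Rightarrow> real
     \<Rightarrow> real \<times> real \<Rightarrow> real \<times> real \<Rightarrow> real^4" where
  "second_fundamental_form J V z u v a b =
     normal_part (range (tangent_vec J V z u v))
       ((fst a * fst b) *\<^sub>R partial_u J (partial_u J z) u v
        + (fst a * snd b + snd a * fst b) *\<^sub>R partial_v V (partial_u J z) u v
        + (snd a * snd b) *\<^sub>R partial_v V (partial_v V z) u v)"

definition orthonormal_frame ::
  "real set \<Rightarrow> real set \<Rightarrow> (real \<Rightarrow> real \<Rightarrow> real^4) \<Rightarrow> real \<Rightarrow> real
     \<Rightarrow> real \<times> real \<Rightarrow> real \<times> real \<Rightarrow> bool" where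
  "orthonormal_frame J V z u v x y \<longleftrightarrow>
     neutral_inner (tangent_vec J V z u v x) (tangent_vec J V z u v x) = 1 \<and>
     neutral_inner (tangent_vec J V z u v y) (tangent_vec J V z u v y) = -1 \<and>
     neutral_inner (tangent_vec J V z u v x) (tangent_vec J V z u v y) = 0"

text \<open>
  Mean curvature vector of a Lorentz surface. Such frames exist exactly when the induced metric
  has signature \<open>(1,1)\<close>, and the value does not depend on the frame.
\<close>

definition mean_curvature ::
  "real set \<Rightarrow> real set \<Rightarrow> (real \<Rightarrow> real \<Rightarrow> real^4) \<Rightarrow> real \<Rightarrow> real \<Rightarrow> real^4" where
  "mean_curvature J V z u v =
     (THE H. \<exists>x y. orthonormal_frame J V z u v x y \<and>
        H = (1/2) *\<^sub>R (second_fundamental_form J V z u v x x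
                     - second_fundamental_form J V z u v y y))"

definition minimal_surface ::
  "real set \<Rightarrow> real set \<Rightarrow> (real \<Rightarrow> real \<Rightarrow> real^4) \<Rightarrow> bool" where
  "minimal_surface J V z \<longleftrightarrow> (\<forall>u\<in>J. \<forall>v\<in>V. mean_curvature J V z u v = 0)"

definition contains_open_part_of_plane ::
  "real set \<Rightarrow> real set \<Rightarrow> (real \<Rightarrow> real \<Rightarrow> real^4) \<Rightarrow> bool" where
  "contains_open_part_of_plane J V z \<longleftrightarrow>
     (\<exists>W P. openin (top_of_set (J \<times> V)) W \<and> W \<noteq> {} \<and> affine P \<and> aff_dim P = 2 \<and>
        (\<lambda>(u, v). z u v) ` W \<subseteq> P)"

section \<open>The general rotational surface of hyperbolic type\<close>

definition rotational_surface ::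
  "real \<Rightarrow> real \<Rightarrow> (real \<Rightarrow> real) \<Rightarrow> (real \<Rightarrow> real) \<Rightarrow> real \<Rightarrow> real \<Rightarrow> real^4" where
  "rotational_surface \<alpha> \<beta> f g u v =
     vector [f u * cosh (\<alpha> * v), g u * cosh (\<beta> * v), f u * sinh (\<alpha> * v), g u * sinh (\<beta> * v)]"

section \<open>Determination of the meridian curve\<close>

text \<open>
  The radicals in \<open>\<alpha> f + \<surd>(\<alpha>\<^sup>2 f\<^sup>2 - A) = C (\<beta> g + \<surd>(\<beta>\<^sup>2 g\<^sup>2 + A))\<^bsup>\<plusminus>\<alpha>/\<beta>\<^esup>\<close>, and the quotients
  \<open>f/g\<close> and \<open>f'/g'\<close> under an arctangent, become singular at isolated parameters of a smooth
  meridian (for instance where \<open>f\<close> has a turning point, \<open>f' = 0\<close>). When such a parameter is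
  crossed, the sign of the exponent or the integration constant changes in general. So these relations are
  required on every interval obtained by cutting \<open>J\<close> at finitely many points, all of them
  singular (in \<open>Z\<close>). Cutting nowhere is allowed and gives the relation on all of \<open>J\<close>.
\<close>

definition on_pieces :: "real set \<Rightarrow> real set \<Rightarrow> (real set \<Rightarrow> bool) \<Rightarrow> bool" where
  "on_pieces J Z P \<longleftrightarrow>
     (\<exists>T. finite T \<and> T \<subseteq> Z \<and> (\<forall>I. is_interval I \<and> I \<subseteq> J - T \<longrightarrow> P I))"

text \<open>
  Real powers are taken of absolute values below: the base may be negative (it has constant sign
  on each piece). For positive bases this is the ordinary power; a negative base amounts to the
  isometry \<open>g \<mapsto> -g\<close> of the surface family, up to renaming the constant and the sign of the
  exponent.
\<close>

definition power_meridian ::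
  "real \<Rightarrow> real \<Rightarrow> (real \<Rightarrow> real) \<Rightarrow> (real \<Rightarrow> real) \<Rightarrow> real set \<Rightarrow> bool" where
  "power_meridian \<alpha> \<beta> f g J \<longleftrightarrow>
     (\<exists>c. c \<noteq> 0 \<and> (\<exists>k\<in>{-(\<alpha>/\<beta>), \<alpha>/\<beta>}. \<forall>u\<in>J. g u \<noteq> 0 \<and> f u = c * \<bar>g u\<bar> powr k))"

definition radical_meridian ::
  "real \<Rightarrow> real \<Rightarrow> (real \<Rightarrow> real) \<Rightarrow> (real \<Rightarrow> real) \<Rightarrow> real set \<Rightarrow> bool" where
  "radical_meridian \<alpha> \<beta> f g J \<longleftrightarrow>
     (\<exists>A. A \<noteq> 0 \<and>
        on_pieces J {u \<in> J. \<alpha>\<^sup>2 * (f u)\<^sup>2 - A = 0 \<or> \<beta>\<^sup>2 * (g u)\<^sup>2 + A = 0}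
          (\<lambda>I. \<exists>C. C \<noteq> 0 \<and> (\<exists>k\<in>{\<alpha>/\<beta>, -(\<alpha>/\<beta>)}. \<forall>u\<in>I.
             \<alpha>\<^sup>2 * (f u)\<^sup>2 - A \<ge> 0 \<and> \<beta>\<^sup>2 * (g u)\<^sup>2 + A \<ge> 0 \<and>
             \<alpha> * f u + sqrt (\<alpha>\<^sup>2 * (f u)\<^sup>2 - A)
               = C * \<bar>\<beta> * g u + sqrt (\<beta>\<^sup>2 * (g u)\<^sup>2 + A)\<bar> powr k)))"

definition arctan_meridian ::
  "(real \<Rightarrow> real) \<Rightarrow> (real \<Rightarrow> real) \<Rightarrow> real set \<Rightarrow> bool" where
  "arctan_meridian f g J \<longleftrightarrow>
     on_pieces J {u \<in> J. g u = 0 \<or> deriv_on J g u = 0}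
       (\<lambda>I. \<exists>c. \<forall>u\<in>I. g u \<noteq> 0 \<and> deriv_on J g u \<noteq> 0 \<and>
          arctan (deriv_on J f u / deriv_on J g u) = - arctan (f u / g u) + c)"

end

theory Submission
  imports Defs
begin

text \<open>
  Write \<open>E = f'\<^sup>2 + g'\<^sup>2\<close> and \<open>G = \<alpha>\<^sup>2 f\<^sup>2 + \<beta>\<^sup>2 g\<^sup>2\<close>, so that the induced metric is \<open>E du\<^sup>2 - G dv\<^sup>2\<close>.
  The mean curvature vector is half the normal part of \<open>z\<^sub>u\<^sub>u/E - z\<^sub>v\<^sub>v/G\<close>, and it has only one component
  that can be nonzero. So minimality is one ordinary differential equation for the meridian
  (\<open>minimal_iff_defect_zero\<close>),
  \<open>G (f'' g' - f' g'') = E (\<alpha>\<^sup>2 f g' - \<beta>\<^sup>2 g f')\<close>.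

  In a parameter \<open>s\<close> with \<open>ds = \<surd>(E/G) du\<close> the metric becomes conformal to \<open>ds\<^sup>2 - dv\<^sup>2\<close> and minimality
  becomes the wave equation, which for this surface means \<open>f\<^sub>s\<^sub>s = \<alpha>\<^sup>2 f\<close> and \<open>g\<^sub>s\<^sub>s = \<beta>\<^sup>2 g\<close>
  (\<open>isothermal_equations\<close>). Hence \<open>A = \<alpha>\<^sup>2 f\<^sup>2 - f\<^sub>s\<^sup>2 = g\<^sub>s\<^sup>2 - \<beta>\<^sup>2 g\<^sup>2\<close> is constant (\<open>first_integral\<close>), and
  its value decides which form the meridian takes. If \<open>A = 0\<close>, then \<open>f\<close> and \<open>g\<close> are exponentials in \<open>s\<close>,
  unless one of them vanishes on an interval, in which case the surface has a planar piece; eliminating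
  \<open>s\<close> gives the power relation. If \<open>A \<noteq> 0\<close>, then \<open>\<alpha> f + \<bar>f\<^sub>s\<bar>\<close> and \<open>\<beta> g + \<bar>g\<^sub>s\<bar>\<close> are exponentials
  in \<open>s\<close> between turning points, of which there is at most one; eliminating \<open>s\<close>
  gives the radical relation. If \<open>\<alpha> = \<beta>\<close>, the equation says directly that the angles
  \<open>arctan (f'/g')\<close> and \<open>arctan (f/g)\<close> have a constant sum, and the first integral shows that
  \<open>g\<close> and \<open>g'\<close> have finitely many zeros.

  Conversely, each of the relations can be differentiated on a dense set of parameters. The power
  and radical relations yield \<open>g'\<^sup>2 (\<alpha>\<^sup>2 f\<^sup>2 - A) = f'\<^sup>2 (\<beta>\<^sup>2 g\<^sup>2 + A)\<close> with nonvanishing \<open>f'\<close> and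
  \<open>g'\<close> on such a set, and differentiating once more gives the curvature equation (\<open>defect_zero_of_conic_relation\<close>).
  By continuity the equation then holds on all of \<open>J\<close>.
\<close>

section \<open>Calculus on an interval with nonempty interior\<close>

lemma interval_point_not_isolated:
  fixes J :: "real set"
  assumes "is_interval J" "interior J \<noteq> {}" "x \<in> J"
  shows "at x within J \<noteq> bot"
proof -
  have "J \<noteq> {x}"
    using assms(2) by auto
  then have "x islimpt J"
    using assms connected_imp_perfect[of J x] is_interval_connected by blast
  then show ?thesis
    by (simp add: trivial_limit_within)
qed

lemma deriv_on_eqI:
  assumes "is_interval J" "interior J \<noteq> {}" "x \<in> J"
    and "(h has_vector_derivative d) (at x within J)"
  shows "deriv_on J h x = d"
  unfolding deriv_on_def
  by (rule vector_derivative_within[OF interval_point_not_isolated[OF assms(1-3)] assms(4)])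

text \<open>
  The curvature equation can be derived from a given meridian relation only where all radicals and
  quotients are differentiable. Those parameters are dense, and this lemma passes to the remaining
  ones, the endpoints of \<open>J\<close> included.
\<close>

lemma continuous_zero_on_dense:
  fixes h :: "real \<Rightarrow> real"
  assumes J: "is_interval J" "interior J \<noteq> {}" and cont: "continuous_on J h"
    and dense: "\<And>U. open U \<Longrightarrow> U \<noteq> {} \<Longrightarrow> U \<subseteq> J \<Longrightarrow> \<exists>u\<in>U. h u = 0"
    and "x \<in> J"
  shows "h x = 0"
proof (rule ccontr)
  assume "h x \<noteq> 0"
  obtain S where "open S" "S \<inter> J = h -` (- {0}) \<inter> J"
    using continuous_on_open_invariant[THEN iffD1, OF cont, rule_format, of "- {0}"]
      open_Compl[OF closed_singleton[of 0]] by metis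
  then have S: "open S" "{u \<in> J. h u \<noteq> 0} = J \<inter> S"
    by blast+
  have "x \<in> closure (interior J)"
    using J \<open>x \<in> J\<close> convex_closure_interior[of J] closure_subset
    by (metis is_interval_convex subsetD)
  moreover have "x \<in> S"
    using S \<open>x \<in> J\<close> \<open>h x \<noteq> 0\<close> by auto
  ultimately have "S \<inter> interior J \<noteq> {}"
    using S(1) closure_iff_nhds_not_empty by blast
  then obtain u where "u \<in> S \<inter> interior J" "h u = 0"
    using dense[of "S \<inter> interior J"] S(1) interior_subset by auto
  then show False
    using S(2) interior_subset by blast
qed

lemma nonzero_continuous_sign:
  fixes h :: "real \<Rightarrow> real"
  assumes "is_interval I" "continuous_on I h" "\<And>u. u \<in> I \<Longrightarrow> h u \<noteq> 0"
  shows "\<exists>s\<in>{-1, 1}. \<forall>u\<in>I. 0 < s * h u"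
proof -
  have "is_interval (h ` I)"
    using assms connected_continuous_image is_interval_connected_1 by blast
  then have "0 \<in> h ` I" if "x \<in> I" "y \<in> I" "h x \<le> 0" "0 \<le> h y" for x y
    using that unfolding is_interval_1 by blast
  then have "(\<forall>u\<in>I. h u > 0) \<or> (\<forall>u\<in>I. h u < 0)"
    using assms(3) by (metis imageE linorder_not_less)
  then show ?thesis
    by auto
qed

lemma mvt_on_interval:
  fixes h :: "real \<Rightarrow> real"
  assumes "is_interval I" "\<And>u. u \<in> I \<Longrightarrow> (h has_real_derivative h' u) (at u within I)"
    and "x \<in> I" "y \<in> I" "x < y"
  shows "\<exists>z\<in>I. h y - h x = h' z * (y - x)"
proof -
  have sub: "{x..y} \<subseteq> I"
    using assms by (meson atLeastAtMost_iff is_interval_1 subsetI)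
  have "\<exists>z\<in>{x<..<y}. h y - h x = h' z * (y - x)"
  proof (rule mvt_simple[OF \<open>x < y\<close>])
    show "(h has_derivative (*) (h' u)) (at u within {x..y})" if "x \<le> u" "u \<le> y" for u
      using that sub assms(2) DERIV_subset by (fastforce simp: has_field_derivative_def)
  qed
  then show ?thesis
    using sub by (meson greaterThanLessThan_iff less_imp_le atLeastAtMost_iff subsetD)
qed

lemma at_most_one_zero:
  fixes h :: "real \<Rightarrow> real"
  assumes I: "is_interval I" "\<And>u. u \<in> I \<Longrightarrow> (h has_real_derivative h' u) (at u within I)"
    and nz: "\<And>u. u \<in> I \<Longrightarrow> h' u \<noteq> 0"
  shows "finite {u \<in> I. h u = 0}"
proof -
  have "x = y" if "x \<in> I" "y \<in> I" "h x = 0" "h y = 0" for x y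
  proof (rule ccontr)
    assume "x \<noteq> y"
    then show False
      using mvt_on_interval[of I h h', OF I, of x y] mvt_on_interval[of I h h', OF I, of y x] that nz
      by (cases "x < y") auto
  qed
  then show ?thesis
    using infinite_arbitrarily_large[of "{u \<in> I. h u = 0}" 2]
    by (metis (mono_tags, lifting) finite.emptyI finite_insert finite_subset mem_Collect_eq singletonI subsetI)
qed

text \<open>
  Gronwall's argument: the two functions \<open>h\<^sup>2 e\<^bsup>\<plusminus>2Mt\<^esup>\<close> are monotone in opposite directions, so
  each of them is at most \<open>0\<close> on one side of the zero \<open>u0\<close>.
\<close>

lemma zero_propagates:
  fixes h :: "real \<Rightarrow> real"
  assumes I: "is_interval I" and h: "\<And>u. u \<in> I \<Longrightarrow> (h has_real_derivative h' u) (at u within I)"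
    and bound: "\<And>u. u \<in> I \<Longrightarrow> \<bar>h' u\<bar> \<le> M * \<bar>h u\<bar>"
    and "u0 \<in> I" "h u0 = 0" "u \<in> I"
  shows "h u = 0"
proof -
  \<comment> \<open>\<open>s\<close> is the sign in the exponent and \<open>w'\<close> the derivative of \<open>w\<close>\<close>
  define w where "w s t = (h t)\<^sup>2 * exp (s * (2 * M) * t)" for s t
  define w' where "w' s t = (2 * (h t * h' t) + s * (2 * M) * (h t)\<^sup>2) * exp (s * (2 * M) * t)" for s t
  have w: "(w s has_real_derivative w' s t) (at t within I)" if "t \<in> I" for s t
    unfolding w_def w'_def
    by (rule derivative_eq_intros h[OF that] refl)+ (simp add: algebra_simps power2_eq_square)
  have le: "\<bar>h t * h' t\<bar> \<le> M * (h t)\<^sup>2" if "t \<in> I" for t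
    using mult_left_mono[OF bound[OF that] abs_ge_zero[of "h t"]]
    by (simp add: abs_mult power2_eq_square algebra_simps)
  have pos: "0 \<le> w' 1 t" and neg: "w' (-1) t \<le> 0" if "t \<in> I" for t
    using le[OF that] unfolding w'_def
    by (auto intro!: mult_nonneg_nonneg mult_nonpos_nonneg)
  have zero: "w s u0 = 0" for s
    using \<open>h u0 = 0\<close> by (simp add: w_def)
  consider "u < u0" | "u0 < u" | "u = u0" by linarith
  then have "\<exists>s. w s u \<le> 0"
  proof cases
    case 1
    obtain z where "z \<in> I" "w 1 u0 - w 1 u = w' 1 z * (u0 - u)"
      using mvt_on_interval[OF I w \<open>u \<in> I\<close> \<open>u0 \<in> I\<close> 1] by blast
    moreover have "0 \<le> w' 1 z * (u0 - u)"
      using pos[OF \<open>z \<in> I\<close>] 1 by simp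
    ultimately show ?thesis
      using zero[of 1] by (intro exI[of _ 1]) linarith
  next
    case 2
    obtain z where "z \<in> I" "w (-1) u - w (-1) u0 = w' (-1) z * (u - u0)"
      using mvt_on_interval[OF I w \<open>u0 \<in> I\<close> \<open>u \<in> I\<close> 2] by blast
    moreover have "w' (-1) z * (u - u0) \<le> 0"
      using neg[OF \<open>z \<in> I\<close>] 2 by (simp add: mult_nonpos_nonneg)
    ultimately show ?thesis
      using zero[of "-1"] by (intro exI[of _ "-1"]) linarith
  qed (use zero in auto)
  then show ?thesis
    by (auto simp: w_def mult_le_0_iff)
qed

lemma zero_propagates_locally:
  fixes h :: "real \<Rightarrow> real"
  assumes J: "is_interval J" and h: "\<And>u. u \<in> J \<Longrightarrow> (h has_real_derivative h' u) (at u within J)"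
    and bound: "\<And>u. u \<in> J \<Longrightarrow> \<bar>h' u\<bar> \<le> c u * \<bar>h u\<bar>"
    and c: "continuous_on J c" and "u0 \<in> J" "h u0 = 0"
  shows "\<exists>S. open S \<and> u0 \<in> S \<and> (\<forall>u\<in>J \<inter> S. h u = 0)"
proof -
  obtain d where d: "d > 0" "\<And>u. u \<in> J \<Longrightarrow> dist u u0 < d \<Longrightarrow> dist (c u) (c u0) < 1"
    using c \<open>u0 \<in> J\<close> unfolding continuous_on_iff by (meson zero_less_one)
  have "h u = 0" if "u \<in> J \<inter> ball u0 d" for u
  proof (rule zero_propagates[of "J \<inter> ball u0 d" h h' "c u0 + 1" u0])
    show "is_interval (J \<inter> ball u0 d)"
      using J by (simp add: is_interval_Int is_interval_ball_real)
    show "(h has_real_derivative h' u) (at u within J \<inter> ball u0 d)" if "u \<in> J \<inter> ball u0 d" for u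
      using that h DERIV_subset by blast
    show "\<bar>h' u\<bar> \<le> (c u0 + 1) * \<bar>h u\<bar>" if "u \<in> J \<inter> ball u0 d" for u
    proof -
      have "\<bar>c u - c u0\<bar> < 1"
        using d(2)[of u] that by (simp add: dist_real_def abs_minus_commute)
      then have "c u * \<bar>h u\<bar> \<le> (c u0 + 1) * \<bar>h u\<bar>"
        by (intro mult_right_mono) auto
      then show ?thesis
        using bound[of u] that by auto
    qed
  qed (use that assms d in auto)
  then show ?thesis
    using d(1) by (intro exI[of _ "ball u0 d"]) auto
qed

text \<open>
  The hypothesis says \<open>(ln \<bar>F\<bar>)' = k (ln \<bar>G\<bar>)'\<close>. Dividing by the power instead of taking logarithms
  keeps the sign of \<open>F\<close>, so that one constant \<open>C\<close>, of either sign, serves the whole interval.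
\<close>

lemma power_relation_of_proportional_log_derivatives:
  fixes F G :: "real \<Rightarrow> real"
  assumes I: "is_interval I"
    and F: "\<And>u. u \<in> I \<Longrightarrow> (F has_real_derivative F' u) (at u within I)" "\<And>u. u \<in> I \<Longrightarrow> F u \<noteq> 0"
    and G: "\<And>u. u \<in> I \<Longrightarrow> (G has_real_derivative G' u) (at u within I)" "\<And>u. u \<in> I \<Longrightarrow> G u \<noteq> 0"
    and proportional: "\<And>u. u \<in> I \<Longrightarrow> F' u * G u = k * (G' u * F u)"
  shows "\<exists>C. C \<noteq> 0 \<and> (\<forall>u\<in>I. F u = C * \<bar>G u\<bar> powr k)"
proof -
  have "continuous_on I G"
    using G(1) by (meson DERIV_continuous_on)
  then obtain s where s: "s \<in> {-1, 1}" "\<And>u. u \<in> I \<Longrightarrow> 0 < s * G u"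
    using nonzero_continuous_sign[OF I, of G] G(2) by blast
  have abs: "\<bar>G u\<bar> = s * G u" if "u \<in> I" for u
    using s(1) s(2)[OF that] by auto
  define H where "H u = F u * (s * G u) powr (- k)" for u
  have "\<exists>C. \<forall>u\<in>I. H u = C"
  proof (rule has_field_derivative_zero_constant)
    show "convex I" using I by (simp add: is_interval_convex)
    fix u assume u: "u \<in> I"
    have Gu: "0 < s * G u" "G u \<noteq> 0" "s \<noteq> 0" using s(1) s(2)[OF u] by auto
    have "((\<lambda>u. (s * G u) powr (-k)) has_real_derivative
            (-k) * (s * G u) powr (-k - 1) * (s * G' u)) (at u within I)"
      by (rule DERIV_chain2[OF has_real_derivative_powr[OF Gu(1)] DERIV_cmult[OF G(1)[OF u]]])
    note DERIV_mult[OF F(1)[OF u] this]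
    moreover have "F' u * (s * G u) powr (-k) +
         ((-k) * (s * G u) powr (-k - 1) * (s * G' u)) * F u = 0"
    proof -
      have "(s * G u) powr (-k) = (s * G u) powr (-k - 1) * (s * G u)"
        using powr_mult_base[OF less_imp_le[OF Gu(1)], of "-k-1"] by (simp add: mult.commute)
      then have "F' u * (s * G u) powr (-k) + ((-k) * (s * G u) powr (-k - 1) * (s * G' u)) * F u
          = (s * G u) powr (-k - 1) * s * (F' u * G u - k * (G' u * F u))"
        by (simp add: algebra_simps)
      then show ?thesis using proportional[OF u] by simp
    qed
    ultimately show "(H has_real_derivative 0) (at u within I)"
      unfolding H_def by simp
  qed
  then obtain C where C: "\<And>u. u \<in> I \<Longrightarrow> H u = C" by blast
  have rel: "F u = C * \<bar>G u\<bar> powr k" if "u \<in> I" for u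
  proof -
    have "(s * G u) powr k \<noteq> 0"
      using s(2)[OF that] by auto
    then show ?thesis
      using C[OF that] by (simp add: abs[OF that] H_def powr_minus field_simps)
  qed
  show ?thesis
  proof (cases "I = {}")
    case True
    then show ?thesis by (auto intro: exI[of _ 1])
  next
    case False
    then have "C \<noteq> 0" using rel F(2) by fastforce
    then show ?thesis using rel by blast
  qed
qed

lemma proportional_log_derivatives_of_power_relation:
  fixes F G :: "real \<Rightarrow> real"
  assumes W: "open W" "u \<in> W"
    and F: "(F has_real_derivative F') (at u)"
    and G: "(G has_real_derivative G') (at u)" "G u \<noteq> 0"
    and rel: "\<And>t. t \<in> W \<Longrightarrow> F t = C * \<bar>G t\<bar> powr k"
  shows "F' * G u = k * (G' * F u)"
proof -
  define s where "s = sgn (G u)"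
  have s: "0 < s * G u" "s \<noteq> 0"
    using G(2) by (auto simp: s_def sgn_if)
  have "((\<lambda>t. C * (s * G t) powr k) has_real_derivative
            C * (k * (s * G u) powr (k - 1) * (s * G'))) (at u)"
    by (intro DERIV_cmult DERIV_chain2[OF has_real_derivative_powr[OF s(1)] DERIV_cmult[OF G(1)]])
  moreover have ev: "\<forall>\<^sub>F t in nhds u. F t = C * (s * G t) powr k"
  proof -
    have "isCont (\<lambda>t. s * G t) u"
      using G(1) DERIV_isCont by (intro continuous_intros) auto
    then have "\<forall>\<^sub>F t in nhds u. 0 < s * G t"
      using s(1) by (metis order_tendstoD(1) isCont_def tendsto_at_iff_tendsto_nhds)
    moreover have "\<forall>\<^sub>F t in nhds u. t \<in> W"
      using W eventually_nhds_in_open by blast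
    ultimately show ?thesis
    proof eventually_elim
      case (elim t)
      then have "\<bar>G t\<bar> = s * G t"
        by (auto simp: s_def sgn_if split: if_splits)
      then show ?case using rel[OF elim(2)] by simp
    qed
  qed
  ultimately have "F' = C * (k * (s * G u) powr (k - 1) * (s * G'))"
    using F DERIV_cong_ev[OF refl ev refl] DERIV_unique by blast
  moreover have "F u = C * (s * G u) powr k"
    using ev eventually_nhds_x_imp_x by fastforce
  moreover have "(s * G u) powr k = (s * G u) powr (k - 1) * (s * G u)"
    using powr_mult_base[OF less_imp_le[OF s(1)], of "k-1"] by (simp add: mult.commute)
  ultimately show ?thesis
    by (simp add: algebra_simps)
qed

lemma open_zero_dichotomy:
  fixes h :: "real \<Rightarrow> real"
  assumes "open U" "U \<noteq> {}" "continuous_on U h"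
  shows "\<exists>W\<subseteq>U. open W \<and> W \<noteq> {} \<and> ((\<forall>u\<in>W. h u = 0) \<or> (\<forall>u\<in>W. h u \<noteq> 0))"
proof (cases "\<forall>u\<in>U. h u = 0")
  case False
  have "open {u \<in> U. h u \<noteq> 0}"
    using continuous_open_preimage[OF assms(3,1) open_Compl[OF closed_singleton[of 0]]]
    by (simp add: vimage_def Int_def)
  then show ?thesis
    using False by (intro exI[of _ "{u \<in> U. h u \<noteq> 0}"]) auto
qed (use assms in blast)

text \<open>
  A finite set of cut points cannot exhaust an open set, so a relation that holds piecewise holds
  on some ball inside any given open set.
\<close>

lemma on_pieces_open:
  assumes "on_pieces J Z P" "open U" "U \<noteq> {}" "U \<subseteq> J"
  shows "\<exists>I\<subseteq>U. open I \<and> I \<noteq> {} \<and> P I"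
proof -
  obtain T where T: "finite T" "\<And>I. is_interval I \<Longrightarrow> I \<subseteq> J - T \<Longrightarrow> P I"
    using assms(1) by (auto simp: on_pieces_def)
  have "U - T \<noteq> {}"
    using T(1) assms(2,3) finite_imp_not_open finite_subset by (metis Diff_eq_empty_iff)
  moreover have "open (U - T)"
    using assms(2) T(1) by (simp add: finite_imp_closed open_Diff)
  ultimately obtain x e where "e > 0" "ball x e \<subseteq> U - T"
    by (metis ex_in_conv open_contains_ball)
  then show ?thesis
    using T(2)[of "ball x e"] assms(4) is_interval_ball_real
    by (intro exI[of _ "ball x e"]) auto
qed

lemma arctan_quotient_derivative:
  fixes x y :: "real \<Rightarrow> real"
  assumes "(x has_real_derivative x') (at u within S)" "(y has_real_derivative y') (at u within S)" "y u \<noteq> 0"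
  shows "((\<lambda>t. arctan (x t / y t)) has_real_derivative (x' * y u - x u * y') / ((x u)\<^sup>2 + (y u)\<^sup>2))
    (at u within S)"
proof -
  have "1 + (x u / y u)\<^sup>2 = ((x u)\<^sup>2 + (y u)\<^sup>2) / (y u)\<^sup>2"
    using assms(3) by (simp add: power_divide add_divide_distrib)
  then show ?thesis
    by (intro DERIV_cong[OF DERIV_chain2[OF DERIV_arctan DERIV_divide[OF assms]]])
      (use assms(3) in \<open>simp add: power2_eq_square[of "y u"]\<close>)
qed

lemma eq_of_square_eq:
  fixes x y :: real
  assumes "x\<^sup>2 = y\<^sup>2" "x * y > 0"
  shows "x = y"
  using assms by (auto simp: power2_eq_iff)

text \<open>
  With \<open>R = sqrt (a\<^sup>2 h\<^sup>2 - B)\<close>, the function \<open>a h + R\<close> has logarithmic derivative \<open>a h' / R\<close>. If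
  the radicand vanishes identically near \<open>t\<close>, then \<open>h\<close> is locally constant, and the formula
  survives with both of its sides zero. Thus both alternatives of the dichotomy can be treated alike.
\<close>

lemma radical_base_derivative:
  fixes h :: "real \<Rightarrow> real"
  assumes W: "open W" "t \<in> W" and h: "(h has_real_derivative h') (at t)" and "a > 0" "B \<noteq> 0"
    and nonneg: "\<And>t. t \<in> W \<Longrightarrow> a\<^sup>2 * (h t)\<^sup>2 - B \<ge> 0"
    and dichotomy: "(\<forall>t\<in>W. a\<^sup>2 * (h t)\<^sup>2 - B = 0) \<or> (\<forall>t\<in>W. a\<^sup>2 * (h t)\<^sup>2 - B \<noteq> 0)"
  defines "R \<equiv> sqrt (a\<^sup>2 * (h t)\<^sup>2 - B)"
  shows "((\<lambda>t. a * h t + sqrt (a\<^sup>2 * (h t)\<^sup>2 - B)) has_real_derivative a * (h' / R) * (a * h t + R)) (at t)"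
    and "h' = (h' / R) * R"
proof -
  have radicand: "((\<lambda>s. a\<^sup>2 * (h s)\<^sup>2 - B) has_real_derivative 2 * a\<^sup>2 * h t * h') (at t)"
    by (rule derivative_eq_intros h refl)+ simp
  have "((\<lambda>t. a * h t + sqrt (a\<^sup>2 * (h t)\<^sup>2 - B)) has_real_derivative a * (h' / R) * (a * h t + R)) (at t) \<and> h' = (h' / R) * R"
    using dichotomy
  proof
    assume const: "\<forall>t\<in>W. a\<^sup>2 * (h t)\<^sup>2 - B = 0"
    have near: "\<forall>\<^sub>F s in nhds t. s \<in> W"
      using eventually_nhds_in_open[OF W] .
    \<comment> \<open>\<open>h\<^sup>2\<close> is locally constant and nonzero, hence \<open>h' = 0\<close>\<close>
    have "((\<lambda>s. a\<^sup>2 * (h s)\<^sup>2 - B) has_real_derivative 0) (at t)"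
      by (rule DERIV_cong_ev[OF refl _ refl, THEN iffD1, OF _ DERIV_const[of 0]])
        (use near const in \<open>auto elim: eventually_mono\<close>)
    then have "2 * a\<^sup>2 * h t * h' = 0"
      using DERIV_unique[OF radicand] by blast
    moreover have "h t \<noteq> 0"
      using const W(2) \<open>B \<noteq> 0\<close> by force
    ultimately have h'0: "h' = 0"
      using \<open>a > 0\<close> by simp
    have linear: "((\<lambda>s. a * h s) has_real_derivative a * h') (at t)"
      by (rule DERIV_cmult[OF h])
    have same: "\<forall>\<^sub>F s in nhds t. a * h s = a * h s + sqrt (a\<^sup>2 * (h s)\<^sup>2 - B)"
      using near by eventually_elim (use const in simp)
    have "((\<lambda>s. a * h s + sqrt (a\<^sup>2 * (h s)\<^sup>2 - B)) has_real_derivative a * h') (at t)"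
      by (rule DERIV_cong_ev[OF refl same refl, THEN iffD1, OF linear])
    then show ?thesis
      by (simp add: h'0)
  next
    assume "\<forall>t\<in>W. a\<^sup>2 * (h t)\<^sup>2 - B \<noteq> 0"
    then have pos: "a\<^sup>2 * (h t)\<^sup>2 - B > 0"
      using nonneg[OF W(2)] W(2) by force
    then have R: "R > 0" by (simp add: R_def)
    have "((\<lambda>s. a * h s + sqrt (a\<^sup>2 * (h s)\<^sup>2 - B)) has_real_derivative
        a * h' + inverse (sqrt (a\<^sup>2 * (h t)\<^sup>2 - B)) / 2 * (2 * a\<^sup>2 * h t * h')) (at t)"
      by (rule DERIV_add[OF DERIV_cmult[OF h]
            DERIV_chain2[where f = sqrt and g = "\<lambda>s. a\<^sup>2 * (h s)\<^sup>2 - B", OF DERIV_real_sqrt[OF pos] radicand]])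
    then show ?thesis
      unfolding R_def[symmetric] using R by (simp add: field_simps power2_eq_square)
  qed
  then show "((\<lambda>t. a * h t + sqrt (a\<^sup>2 * (h t)\<^sup>2 - B)) has_real_derivative a * (h' / R) * (a * h t + R)) (at t)"
    and "h' = (h' / R) * R"
    by blast+
qed

lemma smooth_on_deriv:
  fixes h :: "real \<Rightarrow> real"
  assumes "smooth_on J h" "is_interval J" "interior J \<noteq> {}" "u \<in> J"
  shows "(h has_real_derivative deriv_on J h u) (at u within J)" and "smooth_on J (deriv_on J h)"
proof -
  have "h differentiable_on J"
    using assms(1) unfolding smooth_on_def by (metis funpow_0)
  then have "h differentiable at u within J"
    using assms(4) by (simp add: differentiable_on_def)
  then show "(h has_real_derivative deriv_on J h u) (at u within J)"
    unfolding deriv_on_def has_real_derivative_iff_has_vector_derivative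
    by (simp add: vector_derivative_works)
  show "smooth_on J (deriv_on J h)"
    unfolding smooth_on_def
  proof
    fix n
    have "((deriv_on J ^^ Suc n) h) differentiable_on J"
      using assms(1) unfolding smooth_on_def by blast
    then show "((deriv_on J ^^ n) (deriv_on J h)) differentiable_on J"
      by (simp add: funpow_swap1)
  qed
qed

section \<open>Mean curvature in an orthogonal parametrization\<close>

lemma neutral_inner_simps:
  "neutral_inner (x + y) z = neutral_inner x z + neutral_inner y z"
  "neutral_inner (x - y) z = neutral_inner x z - neutral_inner y z"
  "neutral_inner (c *\<^sub>R x) z = c * neutral_inner x z"
  "neutral_inner z (x + y) = neutral_inner z x + neutral_inner z y"
  "neutral_inner z (c *\<^sub>R x) = c * neutral_inner z x"
  by (simp_all add: neutral_inner_def algebra_simps)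

lemma neutral_inner_commute: "neutral_inner x y = neutral_inner y x"
  by (simp add: neutral_inner_def mult.commute)

text \<open>
  A vector of the plane spanned by \<open>p\<close> and \<open>q\<close> that is orthogonal to the plane vanishes because
  neither basis vector is null; this gives uniqueness in the definite description.
\<close>

lemma normal_part_orthogonal_basis:
  fixes p q :: "real^4"
  assumes "neutral_inner p q = 0" "neutral_inner p p \<noteq> 0" "neutral_inner q q \<noteq> 0"
  shows "normal_part (range (\<lambda>a. fst a *\<^sub>R p + snd a *\<^sub>R q)) w =
     w - (neutral_inner w p / neutral_inner p p) *\<^sub>R p - (neutral_inner w q / neutral_inner q q) *\<^sub>R q"
    (is "normal_part ?T w = ?n")
proof -
  have qp: "neutral_inner q p = 0"
    using assms(1) neutral_inner_commute by metis
  have span: "a *\<^sub>R p + b *\<^sub>R q \<in> ?T" for a b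
    by (rule range_eqI[of _ _ "(a, b)"]) simp
  have perp: "neutral_inner n p = 0 \<and> neutral_inner n q = 0" if "\<forall>t\<in>?T. neutral_inner n t = 0" for n
    using bspec[OF that span[of 1 0]] bspec[OF that span[of 0 1]] by simp
  show ?thesis
    unfolding normal_part_def
  proof (rule the_equality)
    have "w - ?n = (neutral_inner w p / neutral_inner p p) *\<^sub>R p + (neutral_inner w q / neutral_inner q q) *\<^sub>R q"
      by simp
    moreover have np: "neutral_inner ?n p = 0" and nq: "neutral_inner ?n q = 0"
      using assms qp by (simp_all add: neutral_inner_simps)
    have "neutral_inner ?n t = 0" if t: "t \<in> ?T" for t
    proof -
      obtain ab where "t = fst ab *\<^sub>R p + snd ab *\<^sub>R q"
        using t by blast
      then show ?thesis
        by (simp only: neutral_inner_simps(4,5)[of ?n] np nq mult_zero_right add_0)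
    qed
    ultimately show "w - ?n \<in> ?T \<and> (\<forall>t\<in>?T. neutral_inner ?n t = 0)"
      using span by auto
  next
    fix n assume n: "w - n \<in> ?T \<and> (\<forall>t\<in>?T. neutral_inner n t = 0)"
    then obtain a b where ab: "w - n = a *\<^sub>R p + b *\<^sub>R q"
      by auto
    have w: "w = n + a *\<^sub>R p + b *\<^sub>R q"
      using ab by (simp add: algebra_simps)
    have "neutral_inner w p = a * neutral_inner p p" "neutral_inner w q = b * neutral_inner q q"
      using perp[of n] n assms qp unfolding w by (simp_all add: neutral_inner_simps)
    then show "n = ?n"
      using assms(2,3) ab by (simp add: algebra_simps)
  qed
qed

text \<open>
  After rescaling the rows by \<open>\<surd>E\<close> and \<open>\<surd>G\<close>, the two coordinate vectors form a matrix \<open>M\<close> with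
  \<open>M\<^sup>T \<eta> M = \<eta>\<close>, where \<open>\<eta> = diag(1, -1)\<close>. The conclusion is \<open>M \<eta> M\<^sup>T = \<eta>\<close>. Hence the trace of a
  bilinear form is the same in every orthonormal frame.
\<close>

lemma orthonormal_frame_coordinates:
  fixes E G a b c d :: real
  assumes "E > 0" "G > 0"
    and "E * a\<^sup>2 - G * b\<^sup>2 = 1" "E * c\<^sup>2 - G * d\<^sup>2 = -1" "E * (a * c) - G * (b * d) = 0"
  shows "a\<^sup>2 - c\<^sup>2 = 1 / E" "b\<^sup>2 - d\<^sup>2 = - (1 / G)" "a * b = c * d"
proof -
  have ac: "E * (a * c) = G * (b * d)"
    using assms(5) by simp
  have "(E * (a * c))\<^sup>2 = (E * a\<^sup>2) * (E * c\<^sup>2)" "(G * (b * d))\<^sup>2 = (G * b\<^sup>2) * (G * d\<^sup>2)"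
    by algebra+
  then have "(E * a\<^sup>2) * (E * c\<^sup>2) = (E * a\<^sup>2 - 1) * (E * c\<^sup>2 + 1)"
    using assms(3,4) ac by (metis add_diff_cancel_left' diff_minus_eq_add diff_add_cancel diff_diff_eq2 add.commute)
  then have E1: "E * a\<^sup>2 - E * c\<^sup>2 = 1"
    by (simp add: algebra_simps)
  then show "a\<^sup>2 - c\<^sup>2 = 1 / E"
    using assms(1) by (simp add: field_simps)
  have G1: "G * d\<^sup>2 - G * b\<^sup>2 = 1"
    using E1 assms(3,4) by linarith
  then show "b\<^sup>2 - d\<^sup>2 = - (1 / G)"
    using assms(2) by (simp add: field_simps)
  have "E * a * (a * b - c * d) = 0"
  proof -
    have "E * a * (a * b - c * d) = (E * a\<^sup>2) * b - (E * (a * c)) * d"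
      by algebra
    also have "\<dots> = b * (E * a\<^sup>2 - G * d\<^sup>2)"
      unfolding ac by algebra
    also have "E * a\<^sup>2 - G * d\<^sup>2 = 0"
      using G1 assms(3) by linarith
    finally show ?thesis by simp
  qed
  moreover have "E * a\<^sup>2 > 0"
    using assms(2,3) by (smt (verit) mult_nonneg_nonneg zero_le_power2)
  ultimately show "a * b = c * d"
    by auto
qed

text \<open>
  The rescaled coordinate vectors form one orthonormal frame; every other frame gives the same value,
  and the mixed derivative drops out, because of the relations between the frame coordinates.
\<close>

lemma mean_curvature_orthogonal:
  fixes z :: "real \<Rightarrow> real \<Rightarrow> real^4"
  assumes p: "partial_u J z u v = p" and q: "partial_v V z u v = q"
    and "neutral_inner p q = 0" "neutral_inner p p = E" "neutral_inner q q = - G" "E > 0" "G > 0"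
  shows "mean_curvature J V z u v = (1/2) *\<^sub>R normal_part (range (\<lambda>a. fst a *\<^sub>R p + snd a *\<^sub>R q))
     ((1 / E) *\<^sub>R partial_u J (partial_u J z) u v - (1 / G) *\<^sub>R partial_v V (partial_v V z) u v)"
proof -
  let ?N = "normal_part (range (\<lambda>a. fst a *\<^sub>R p + snd a *\<^sub>R q))"
  let ?W = "(1 / E) *\<^sub>R partial_u J (partial_u J z) u v - (1 / G) *\<^sub>R partial_v V (partial_v V z) u v"
  have T: "tangent_vec J V z u v = (\<lambda>a. fst a *\<^sub>R p + snd a *\<^sub>R q)"
    by (simp add: fun_eq_iff tangent_vec_def p q)
  have N: "?N w = w - (neutral_inner w p / E) *\<^sub>R p - (neutral_inner w q / (- G)) *\<^sub>R q" for w
    using normal_part_orthogonal_basis[of p q w] assms by auto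
  have N_diff: "?N x - ?N y = ?N (x - y)" for x y
    unfolding N by (simp add: neutral_inner_simps algebra_simps diff_divide_distrib)
  have qp: "neutral_inner q p = 0"
    using assms(3) neutral_inner_commute by metis
  have frame: "orthonormal_frame J V z u v (a, b) (c, d) \<longleftrightarrow>
      E * a\<^sup>2 - G * b\<^sup>2 = 1 \<and> E * c\<^sup>2 - G * d\<^sup>2 = -1 \<and> E * (a * c) - G * (b * d) = 0" for a b c d
    using assms(3-5) qp unfolding orthonormal_frame_def T
    by (simp add: neutral_inner_simps algebra_simps power2_eq_square)
  have sff: "second_fundamental_form J V z u v x x - second_fundamental_form J V z u v y y = ?N ?W"
    if "orthonormal_frame J V z u v x y" for x y
  proof -
    obtain a b c d where xy: "x = (a, b)" "y = (c, d)"
      by (metis surj_pair)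
    have abcd: "a\<^sup>2 - c\<^sup>2 = 1 / E" "b\<^sup>2 - d\<^sup>2 = - (1 / G)" "a * b = c * d"
      using orthonormal_frame_coordinates[of E G a b c d] that assms(6,7) unfolding xy frame by auto
    have "second_fundamental_form J V z u v x x - second_fundamental_form J V z u v y y =
      ?N ((a\<^sup>2 - c\<^sup>2) *\<^sub>R partial_u J (partial_u J z) u v
        + (2 * (a * b) - 2 * (c * d)) *\<^sub>R partial_v V (partial_u J z) u v
        + (b\<^sup>2 - d\<^sup>2) *\<^sub>R partial_v V (partial_v V z) u v)"
      unfolding second_fundamental_form_def T N_diff xy
      by (rule arg_cong[where f = ?N]) (simp add: algebra_simps power2_eq_square)
    then show ?thesis
      unfolding abcd by simp
  qed
  have exists: "orthonormal_frame J V z u v (1 / sqrt E, 0) (0, 1 / sqrt G)"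
    unfolding frame using assms(6,7) by (simp add: power_divide)
  show ?thesis
    unfolding mean_curvature_def
  proof (rule the_equality)
    show "\<exists>x y. orthonormal_frame J V z u v x y \<and>
      (1/2) *\<^sub>R ?N ?W = (1/2) *\<^sub>R (second_fundamental_form J V z u v x x - second_fundamental_form J V z u v y y)"
      by (intro exI conjI, rule exists) (simp only: sff[OF exists])
  next
    fix H
    assume "\<exists>x y. orthonormal_frame J V z u v x y \<and>
      H = (1/2) *\<^sub>R (second_fundamental_form J V z u v x x - second_fundamental_form J V z u v y y)"
    then obtain x y where xy: "orthonormal_frame J V z u v x y"
      "H = (1/2) *\<^sub>R (second_fundamental_form J V z u v x x - second_fundamental_form J V z u v y y)"
      by (elim exE conjE)
    then show "H = (1/2) *\<^sub>R ?N ?W"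
      by (simp only: sff[OF xy(1)])
  qed
qed

lemma vector4_nth [simp]:
  "(vector [a, b, c, d] :: 'a::zero^4) $ 1 = a"
  "(vector [a, b, c, d] :: 'a::zero^4) $ 2 = b"
  "(vector [a, b, c, d] :: 'a::zero^4) $ 3 = c"
  "(vector [a, b, c, d] :: 'a::zero^4) $ 4 = d"
  by (simp_all add: vector_def)

lemma has_vector_derivative_vector4:
  assumes "(a has_real_derivative a') (at x within S)" "(b has_real_derivative b') (at x within S)"
    "(c has_real_derivative c') (at x within S)" "(d has_real_derivative d') (at x within S)"
  shows "((\<lambda>t. vector [a t, b t, c t, d t] :: real^4) has_vector_derivative vector [a', b', c', d'])
      (at x within S)"
proof -
  have eq: "vector [s, t, v, w] = s *\<^sub>R axis 1 1 + t *\<^sub>R axis 2 1 + v *\<^sub>R axis 3 1 + w *\<^sub>R (axis 4 1 :: real^4)"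
    for s t v w :: real
    by (simp add: vec_eq_iff forall_4 axis_def)
  show ?thesis
    unfolding eq
    by (intro has_vector_derivative_add)
      (use assms in \<open>auto intro!: derivative_eq_intros simp: has_real_derivative_iff_has_vector_derivative[symmetric]\<close>)
qed

section \<open>Surfaces with a piece in a coordinate plane\<close>

lemma contains_open_part_of_coordinate_plane:
  fixes z :: "real \<Rightarrow> real \<Rightarrow> real^4"
  assumes "open S" "u0 \<in> J \<inter> S" "V \<noteq> {}" "i \<noteq> j"
    and z: "\<And>u v. u \<in> J \<inter> S \<Longrightarrow> v \<in> V \<Longrightarrow> z u v \<in> span {axis i 1, axis j 1}"
  shows "contains_open_part_of_plane J V z"
proof -
  let ?B = "{axis i 1, axis j 1 :: real^4}"
  have "independent ?B"
    by (rule independent_mono[OF independent_Basis]) (simp add: axis_in_Basis_iff)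
  moreover have "card ?B = 2"
    using \<open>i \<noteq> j\<close> by (simp add: axis_eq_axis)
  ultimately have "aff_dim (span ?B) = 2"
    by (simp add: aff_dim_subspace dim_eq_card_independent)
  moreover have "affine (span ?B)"
    by (simp add: subspace_imp_affine)
  moreover have "openin (top_of_set (J \<times> V)) ((J \<inter> S) \<times> V)"
    by (intro openin_Times openin_open_Int assms(1)) simp
  moreover have "(\<lambda>(u, v). z u v) ` ((J \<inter> S) \<times> V) \<subseteq> span ?B"
    using z by auto
  moreover have "(J \<inter> S) \<times> V \<noteq> {}"
    using assms(2,3) by auto
  ultimately show ?thesis
    unfolding contains_open_part_of_plane_def by blast
qed

text \<open>
  When one coordinate function of the meridian vanishes, the surface stays in the plane of the
  first and third, or of the second and fourth, coordinate axes.
\<close>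

lemma planar_if_meridian_on_axis:
  assumes "open S" "u0 \<in> J \<inter> S"
    and "(\<forall>u\<in>J \<inter> S. f u = 0) \<or> (\<forall>u\<in>J \<inter> S. g u = 0)"
  shows "contains_open_part_of_plane J {0..<2 * pi} (rotational_surface \<alpha> \<beta> f g)"
proof -
  have decomp: "vector [a, b, c, d] = a *\<^sub>R axis 1 1 + b *\<^sub>R axis 2 1 + c *\<^sub>R axis 3 1 + d *\<^sub>R (axis 4 1 :: real^4)"
    for a b c d :: real
    by (simp add: vec_eq_iff forall_4 axis_def)
  have V: "{0..<2 * pi} \<noteq> {}"
    using pi_gt_zero by (simp del: pi_gt_zero)
  from assms(3) show ?thesis
  proof
    assume "\<forall>u\<in>J \<inter> S. f u = 0"
    then show ?thesis
      by (intro contains_open_part_of_coordinate_plane[OF assms(1,2) V, of 2 4])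
        (auto simp: rotational_surface_def decomp intro!: span_add span_scale intro: span_base)
  next
    assume "\<forall>u\<in>J \<inter> S. g u = 0"
    then show ?thesis
      by (intro contains_open_part_of_coordinate_plane[OF assms(1,2) V, of 1 3])
        (auto simp: rotational_surface_def decomp intro!: span_add span_scale intro: span_base)
  qed
qed

section \<open>The meridian equation\<close>

text \<open>
  The functions \<open>f1, f2, g1, g2\<close> stand for the first and second derivatives of \<open>f\<close> and \<open>g\<close>.
\<close>

locale rotational_meridian =
  fixes \<alpha> \<beta> :: real and f g f1 g1 f2 g2 :: "real \<Rightarrow> real" and J :: "real set"
  assumes J: "is_interval J" "interior J \<noteq> {}"
    and \<alpha>: "\<alpha> > 0" and \<beta>: "\<beta> > 0"
    and f: "\<And>u. u \<in> J \<Longrightarrow> (f has_real_derivative f1 u) (at u within J)"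
    and g: "\<And>u. u \<in> J \<Longrightarrow> (g has_real_derivative g1 u) (at u within J)"
    and f1: "\<And>u. u \<in> J \<Longrightarrow> (f1 has_real_derivative f2 u) (at u within J)"
    and g1: "\<And>u. u \<in> J \<Longrightarrow> (g1 has_real_derivative g2 u) (at u within J)"
    and f2: "continuous_on J f2" and g2: "continuous_on J g2"
    and G_pos: "\<And>u. u \<in> J \<Longrightarrow> \<alpha>\<^sup>2 * (f u)\<^sup>2 + \<beta>\<^sup>2 * (g u)\<^sup>2 > 0"
    and E_pos: "\<And>u. u \<in> J \<Longrightarrow> (f1 u)\<^sup>2 + (g1 u)\<^sup>2 > 0"
begin

definition E :: "real \<Rightarrow> real" where "E u = (f1 u)\<^sup>2 + (g1 u)\<^sup>2"
definition G :: "real \<Rightarrow> real" where "G u = \<alpha>\<^sup>2 * (f u)\<^sup>2 + \<beta>\<^sup>2 * (g u)\<^sup>2"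

text \<open>
  Up to a positive factor, the component of \<open>z\<^sub>u\<^sub>u/E - z\<^sub>v\<^sub>v/G\<close> along the normal
  \<open>(g' cosh \<alpha>v, -f' cosh \<beta>v, g' sinh \<alpha>v, -f' sinh \<beta>v)\<close>; here \<open>E = <z\<^sub>u, z\<^sub>u>\<close> and \<open>-G = <z\<^sub>v, z\<^sub>v>\<close>.
\<close>

definition defect :: "real \<Rightarrow> real" where
  "defect u = G u * (f2 u * g1 u - f1 u * g2 u) - E u * (\<alpha>\<^sup>2 * f u * g1 u - \<beta>\<^sup>2 * g u * f1 u)"

lemma EG [simp]: "u \<in> J \<Longrightarrow> E u > 0" "u \<in> J \<Longrightarrow> G u > 0"
  using E_pos G_pos by (simp_all add: E_def G_def)

lemma continuous_meridian: "continuous_on J f" "continuous_on J g" "continuous_on J f1" "continuous_on J g1"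
  using f g f1 g1 by (meson DERIV_continuous_on)+

lemma interior_deriv:
  assumes "open U" "U \<subseteq> J" "u \<in> U"
  shows "(f has_real_derivative f1 u) (at u)" "(g has_real_derivative g1 u) (at u)"
    "(f1 has_real_derivative f2 u) (at u)" "(g1 has_real_derivative g2 u) (at u)"
  using f[of u] g[of u] f1[of u] g1[of u] assms
  by (metis DERIV_subset at_within_open subsetD)+

lemma deriv_on_fg: "u \<in> J \<Longrightarrow> deriv_on J f u = f1 u" "u \<in> J \<Longrightarrow> deriv_on J g u = g1 u"
  using f g by (auto intro!: deriv_on_eqI J simp: has_real_derivative_iff_has_vector_derivative[symmetric])

text \<open>
  The vectors \<open>z\<^sub>u\<close>, \<open>z\<^sub>u\<^sub>u\<close> and \<open>z\<^sub>v\<^sub>v\<close> all lie in the plane spanned by \<open>(cosh \<alpha>v, 0, sinh \<alpha>v, 0)\<close> and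
  \<open>(0, cosh \<beta>v, 0, sinh \<beta>v)\<close>, which is orthogonal to \<open>z\<^sub>v\<close>. Therefore \<open>2H\<close> is the part of
  \<open>z\<^sub>u\<^sub>u/E - z\<^sub>v\<^sub>v/G\<close> orthogonal to \<open>z\<^sub>u\<close> inside this plane, and it vanishes exactly if that
  vector is parallel to \<open>z\<^sub>u\<close>, a single scalar condition that does not involve \<open>v\<close>.
\<close>

lemma minimal_iff_defect_zero:
  "minimal_surface J {0..<2 * pi} (rotational_surface \<alpha> \<beta> f g) \<longleftrightarrow> (\<forall>u\<in>J. defect u = 0)"
proof -
  let ?V = "{0..<2 * pi}" and ?z = "rotational_surface \<alpha> \<beta> f g"
  have V: "is_interval ?V" "interior ?V \<noteq> {}"
    using pi_gt_zero by (auto simp: is_interval_1 interior_atLeastLessThan simp del: pi_gt_zero)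
  define zu where "zu u v = (vector [f1 u * cosh (\<alpha> * v), g1 u * cosh (\<beta> * v),
      f1 u * sinh (\<alpha> * v), g1 u * sinh (\<beta> * v)] :: real^4)" for u v
  define zv where "zv u v = (vector [\<alpha> * f u * sinh (\<alpha> * v), \<beta> * g u * sinh (\<beta> * v),
      \<alpha> * f u * cosh (\<alpha> * v), \<beta> * g u * cosh (\<beta> * v)] :: real^4)" for u v
  define zuu where "zuu u v = (vector [f2 u * cosh (\<alpha> * v), g2 u * cosh (\<beta> * v),
      f2 u * sinh (\<alpha> * v), g2 u * sinh (\<beta> * v)] :: real^4)" for u v
  define zvv where "zvv u v = (vector [\<alpha>\<^sup>2 * f u * cosh (\<alpha> * v), \<beta>\<^sup>2 * g u * cosh (\<beta> * v),
      \<alpha>\<^sup>2 * f u * sinh (\<alpha> * v), \<beta>\<^sup>2 * g u * sinh (\<beta> * v)] :: real^4)" for u v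
  have pu: "partial_u J ?z u v = zu u v" if "u \<in> J" for u v
    unfolding partial_u_def rotational_surface_def zu_def
    by (rule deriv_on_eqI[OF J that])
      (auto intro!: has_vector_derivative_vector4 derivative_eq_intros f g that)
  have puu: "partial_u J (partial_u J ?z) u v = zuu u v" if "u \<in> J" for u v
  proof -
    have "((\<lambda>s. zu s v) has_vector_derivative zuu u v) (at u within J)"
      unfolding zu_def zuu_def
      by (auto intro!: has_vector_derivative_vector4 derivative_eq_intros f1 g1 that)
    then have "((\<lambda>s. partial_u J ?z s v) has_vector_derivative zuu u v) (at u within J)"
      by (rule has_vector_derivative_transform[OF that, rotated]) (rule pu)
    then show ?thesis
      unfolding partial_u_def[of J "partial_u J ?z"] by (rule deriv_on_eqI[OF J that])
  qed
  have pv: "partial_v ?V ?z u v = zv u v" if "v \<in> ?V" for u v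
    unfolding partial_v_def rotational_surface_def zv_def
    by (rule deriv_on_eqI[OF V that])
      (auto intro!: has_vector_derivative_vector4 derivative_eq_intros)
  have pvv: "partial_v ?V (partial_v ?V ?z) u v = zvv u v" if "v \<in> ?V" for u v
  proof -
    have "((\<lambda>s. zv u s) has_vector_derivative zvv u v) (at v within ?V)"
      unfolding zv_def zvv_def
      by (auto intro!: has_vector_derivative_vector4 derivative_eq_intros simp: power2_eq_square)
    then have "((\<lambda>s. partial_v ?V ?z u s) has_vector_derivative zvv u v) (at v within ?V)"
      by (rule has_vector_derivative_transform[OF that, rotated]) (rule pv)
    then show ?thesis
      unfolding partial_v_def[of ?V "partial_v ?V ?z"] by (rule deriv_on_eqI[OF V that])
  qed
  have "mean_curvature J ?V ?z u v = 0 \<longleftrightarrow> defect u = 0" if u: "u \<in> J" and v: "v \<in> ?V" for u v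
  proof -
    let ?p = "zu u v" and ?q = "zv u v"
    let ?a = "cosh (\<alpha> * v)" and ?b = "sinh (\<alpha> * v)" and ?c = "cosh (\<beta> * v)" and ?d = "sinh (\<beta> * v)"
    let ?w = "(1 / E u) *\<^sub>R zuu u v - (1 / G u) *\<^sub>R zvv u v"
    have hyp: "?a\<^sup>2 - ?b\<^sup>2 = 1" "?c\<^sup>2 - ?d\<^sup>2 = 1"
      by (simp_all add: cosh_square_eq)
    have pq: "neutral_inner ?p ?q = 0"
      by (simp add: neutral_inner_def zu_def zv_def)
    have pp: "neutral_inner ?p ?p = E u"
    proof -
      have "neutral_inner ?p ?p = (f1 u)\<^sup>2 * (?a\<^sup>2 - ?b\<^sup>2) + (g1 u)\<^sup>2 * (?c\<^sup>2 - ?d\<^sup>2)"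
        by (simp add: neutral_inner_def zu_def power2_eq_square algebra_simps)
      then show ?thesis by (simp add: hyp E_def)
    qed
    have qq: "neutral_inner ?q ?q = - G u"
    proof -
      have "neutral_inner ?q ?q = - (\<alpha>\<^sup>2 * (f u)\<^sup>2 * (?a\<^sup>2 - ?b\<^sup>2) + \<beta>\<^sup>2 * (g u)\<^sup>2 * (?c\<^sup>2 - ?d\<^sup>2))"
        by (simp add: neutral_inner_def zv_def power2_eq_square algebra_simps)
      then show ?thesis by (simp add: hyp G_def)
    qed
    define w1 where "w1 = f2 u / E u - \<alpha>\<^sup>2 * f u / G u"
    define w2 where "w2 = g2 u / E u - \<beta>\<^sup>2 * g u / G u"
    have w: "?w = vector [w1 * ?a, w2 * ?c, w1 * ?b, w2 * ?d]"
      by (simp add: vec_eq_iff forall_4 zuu_def zvv_def w1_def w2_def algebra_simps)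
    have wp: "neutral_inner ?w ?p = w1 * f1 u + w2 * g1 u"
    proof -
      have "neutral_inner ?w ?p = w1 * f1 u * (?a\<^sup>2 - ?b\<^sup>2) + w2 * g1 u * (?c\<^sup>2 - ?d\<^sup>2)"
        unfolding w by (simp add: neutral_inner_def zu_def power2_eq_square algebra_simps)
      then show ?thesis by (simp add: hyp)
    qed
    have wq: "neutral_inner ?w ?q = 0"
      unfolding w by (simp add: neutral_inner_def zv_def)
    have "mean_curvature J ?V ?z u v =
        (1/2) *\<^sub>R normal_part (range (\<lambda>a. fst a *\<^sub>R ?p + snd a *\<^sub>R ?q)) ?w"
      using mean_curvature_orthogonal[OF pu[OF u, of v] pv[OF v, of u] pq pp qq] u
      by (simp add: puu[OF u] pvv[OF v])
    also have "\<dots> = (1/2) *\<^sub>R (?w - ((w1 * f1 u + w2 * g1 u) / E u) *\<^sub>R ?p)"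
      using normal_part_orthogonal_basis[OF pq, of ?w] EG[OF u] by (simp add: pp qq wp wq)
    finally have H: "mean_curvature J ?V ?z u v = 0 \<longleftrightarrow> ?w = ((w1 * f1 u + w2 * g1 u) / E u) *\<^sub>R ?p"
      by simp
    have ac: "?a \<noteq> 0" "?c \<noteq> 0" by auto
    have parallel: "?w = m *\<^sub>R ?p \<longleftrightarrow> w1 = m * f1 u \<and> w2 = m * g1 u" for m
      unfolding w using ac by (auto simp: vec_eq_iff forall_4 zu_def simp flip: mult.assoc)
    have "?w = ((w1 * f1 u + w2 * g1 u) / E u) *\<^sub>R ?p \<longleftrightarrow>
      w1 = (w1 * f1 u + w2 * g1 u) / E u * f1 u \<and> w2 = (w1 * f1 u + w2 * g1 u) / E u * g1 u"
      by (rule parallel)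
    also have "\<dots> \<longleftrightarrow> w1 * E u = (w1 * f1 u + w2 * g1 u) * f1 u \<and> w2 * E u = (w1 * f1 u + w2 * g1 u) * g1 u"
      using EG(1)[OF u] by (simp add: field_simps)
    also have "\<dots> \<longleftrightarrow> g1 u * (w1 * g1 u - w2 * f1 u) = 0 \<and> f1 u * (w1 * g1 u - w2 * f1 u) = 0"
      unfolding E_def by (auto simp: power2_eq_square algebra_simps)
    also have "\<dots> \<longleftrightarrow> w1 * g1 u - w2 * f1 u = 0"
      using E_pos[OF u] by auto
    also have "\<dots> \<longleftrightarrow> defect u = 0"
    proof -
      have "w1 * g1 u - w2 * f1 u = defect u / (E u * G u)"
        using EG[OF u] unfolding w1_def w2_def defect_def by (simp add: field_simps)
      then show ?thesis
        using EG[OF u] by simp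
    qed
    finally show ?thesis
      using H by simp
  qed
  moreover have "(0::real) \<in> ?V" by simp
  ultimately show ?thesis
    unfolding minimal_surface_def by blast
qed

lemma continuous_defect: "continuous_on J defect"
  unfolding defect_def E_def G_def
  by (intro continuous_intros continuous_meridian f2 g2)

section \<open>The isothermal parameter and its first integral\<close>

text \<open>
  If the parameter \<open>s\<close> satisfies \<open>ds = du / r\<close>, then \<open>(s, v)\<close> are isothermal coordinates: \<open>z\<^sub>s\<close> has square
  \<open>G\<close>, opposite to that of \<open>z\<^sub>v\<close>. The functions \<open>p\<close> and \<open>q\<close> are the derivatives \<open>f\<^sub>s\<close> and \<open>g\<^sub>s\<close>, kept as
  functions of \<open>u\<close> so that no change of parameter has to be carried out.
\<close>

definition r :: "real \<Rightarrow> real" where "r u = sqrt (G u / E u)"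
definition p :: "real \<Rightarrow> real" where "p u = f1 u * r u"
definition q :: "real \<Rightarrow> real" where "q u = g1 u * r u"

lemma r_pos: "u \<in> J \<Longrightarrow> r u > 0"
  by (simp add: r_def)

lemma r_square: "u \<in> J \<Longrightarrow> E u * (r u)\<^sup>2 = G u"
  using EG[of u] by (simp add: r_def real_sqrt_pow2 less_imp_le less_imp_neq[symmetric])

lemma pq_sum: "u \<in> J \<Longrightarrow> (p u)\<^sup>2 + (q u)\<^sup>2 = G u"
  using r_square[of u] by (simp add: p_def q_def E_def power_mult_distrib algebra_simps)

lemma continuous_rpq: "continuous_on J r" "continuous_on J p" "continuous_on J q"
proof -
  show "continuous_on J r"
    unfolding r_def E_def G_def using E_pos
    by (intro continuous_intros continuous_meridian) (metis less_irrefl)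
  then show "continuous_on J p" "continuous_on J q"
    unfolding p_def q_def by (intro continuous_intros continuous_meridian; assumption)+
qed

lemma r_deriv:
  assumes u: "u \<in> J" 
  shows "(r has_real_derivative ((\<alpha>\<^sup>2 * f u * f1 u + \<beta>\<^sup>2 * g u * g1 u) * E u
     - G u * (f1 u * f2 u + g1 u * g2 u)) / ((E u)\<^sup>2 * r u)) (at u within J)"
proof -
  have "((\<lambda>u. G u / E u) has_real_derivative (2 * (\<alpha>\<^sup>2 * f u * f1 u + \<beta>\<^sup>2 * g u * g1 u) * E u
     - G u * (2 * (f1 u * f2 u + g1 u * g2 u))) / (E u * E u)) (at u within J)"
    using E_pos[OF u] unfolding E_def G_def
    by (auto intro!: derivative_eq_intros f g f1 g1 u simp: algebra_simps)
  then have "(r has_real_derivative (inverse (sqrt (G u / E u)) / 2) *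
     ((2 * (\<alpha>\<^sup>2 * f u * f1 u + \<beta>\<^sup>2 * g u * g1 u) * E u
     - G u * (2 * (f1 u * f2 u + g1 u * g2 u))) / (E u * E u))) (at u within J)"
    unfolding r_def using EG[OF u] by (intro DERIV_chain2[OF DERIV_real_sqrt]) auto
  then show ?thesis
    by (rule DERIV_cong) (use EG[OF u] r_pos[OF u] in \<open>simp add: r_def[symmetric] field_simps power2_eq_square\<close>)
qed

text \<open>
  In isothermal coordinates minimality is the wave equation \<open>z\<^sub>s\<^sub>s = z\<^sub>v\<^sub>v\<close>, that is,
  \<open>f\<^sub>s\<^sub>s = \<alpha>\<^sup>2 f\<close> and \<open>g\<^sub>s\<^sub>s = \<beta>\<^sup>2 g\<close>.
\<close>

lemma isothermal_equations:
  assumes u: "u \<in> J" and "defect u = 0"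
  shows "(p has_real_derivative \<alpha>\<^sup>2 * f u / r u) (at u within J)"
    and "(q has_real_derivative \<beta>\<^sup>2 * g u / r u) (at u within J)"
proof -
  define X where "X = (\<alpha>\<^sup>2 * f u * f1 u + \<beta>\<^sup>2 * g u * g1 u) * E u - G u * (f1 u * f2 u + g1 u * g2 u)"
  have r': "(r has_real_derivative X / ((E u)\<^sup>2 * r u)) (at u within J)"
    using r_deriv[OF u] by (simp add: X_def)
  have pos: "E u > 0" "r u > 0"
    using u r_pos by auto
  have D: "G u * (f2 u * g1 u - f1 u * g2 u) = E u * (\<alpha>\<^sup>2 * f u * g1 u - \<beta>\<^sup>2 * g u * f1 u)"
    using assms(2) by (simp add: defect_def)
  have "f2 u * G u * E u + f1 u * X = \<alpha>\<^sup>2 * f u * (E u)\<^sup>2"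
    "g2 u * G u * E u + g1 u * X = \<beta>\<^sup>2 * g u * (E u)\<^sup>2"
    using D unfolding X_def E_def by algebra+
  then have eqs: "(E u)\<^sup>2 * (f2 u * (r u)\<^sup>2) + f1 u * X = \<alpha>\<^sup>2 * f u * (E u)\<^sup>2"
    "(E u)\<^sup>2 * (g2 u * (r u)\<^sup>2) + g1 u * X = \<beta>\<^sup>2 * g u * (E u)\<^sup>2"
    unfolding r_square[OF u, symmetric] by (simp_all add: algebra_simps power2_eq_square)
  show "(p has_real_derivative \<alpha>\<^sup>2 * f u / r u) (at u within J)"
    unfolding p_def
    by (rule DERIV_cong[OF DERIV_mult[OF f1[OF u] r']])
      (use pos eqs(1) in \<open>simp add: field_simps power2_eq_square\<close>)
  show "(q has_real_derivative \<beta>\<^sup>2 * g u / r u) (at u within J)"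
    unfolding q_def
    by (rule DERIV_cong[OF DERIV_mult[OF g1[OF u] r']])
      (use pos eqs(2) in \<open>simp add: field_simps power2_eq_square\<close>)
qed

text \<open>
  The linear equation \<open>f\<^sub>s\<^sub>s = \<alpha>\<^sup>2 f\<close> conserves the energy \<open>\<alpha>\<^sup>2 f\<^sup>2 - f\<^sub>s\<^sup>2\<close>. Since \<open>p\<^sup>2 + q\<^sup>2 = G\<close>, the energy
  of \<open>g\<close> is the negative of the energy of \<open>f\<close>.
\<close>

lemma first_integral:
  assumes "\<And>u. u \<in> J \<Longrightarrow> defect u = 0"
  shows "\<exists>A. \<forall>u\<in>J. (p u)\<^sup>2 = \<alpha>\<^sup>2 * (f u)\<^sup>2 - A \<and> (q u)\<^sup>2 = \<beta>\<^sup>2 * (g u)\<^sup>2 + A"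
proof -
  have "\<exists>A. \<forall>u\<in>J. \<alpha>\<^sup>2 * (f u)\<^sup>2 - (p u)\<^sup>2 = A"
  proof (rule has_field_derivative_zero_constant)
    show "convex J" using J by (simp add: is_interval_convex)
    fix u assume u: "u \<in> J"
    show "((\<lambda>u. \<alpha>\<^sup>2 * (f u)\<^sup>2 - (p u)\<^sup>2) has_real_derivative 0) (at u within J)"
      by (rule derivative_eq_intros f[OF u] isothermal_equations[OF u assms[OF u]] refl)+
        (use r_pos[OF u] in \<open>simp add: p_def\<close>)
  qed
  then obtain A where A: "\<And>u. u \<in> J \<Longrightarrow> \<alpha>\<^sup>2 * (f u)\<^sup>2 - (p u)\<^sup>2 = A" by blast
  have "(p u)\<^sup>2 = \<alpha>\<^sup>2 * (f u)\<^sup>2 - A \<and> (q u)\<^sup>2 = \<beta>\<^sup>2 * (g u)\<^sup>2 + A" if "u \<in> J" for u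
    using A[OF that] pq_sum[OF that] by (auto simp: G_def)
  then show ?thesis by blast
qed

section \<open>From minimality to the meridian\<close>

text \<open>
  Zero energy means \<open>\<bar>f\<^sub>s\<bar> = \<alpha> \<bar>f\<bar>\<close>. By Gronwall's argument, \<open>f\<close> vanishes near each of its zeros, which
  would put a piece of the surface into a coordinate plane. The same holds for \<open>g\<close>.
\<close>

lemma nonvanishing_if_first_integral_zero:
  assumes null: "\<And>u. u \<in> J \<Longrightarrow> (p u)\<^sup>2 = \<alpha>\<^sup>2 * (f u)\<^sup>2 \<and> (q u)\<^sup>2 = \<beta>\<^sup>2 * (g u)\<^sup>2"
    and not_planar: "\<not> contains_open_part_of_plane J {0..<2 * pi} (rotational_surface \<alpha> \<beta> f g)"
    and u: "u \<in> J"
  shows "f u \<noteq> 0" "g u \<noteq> 0" "p u \<noteq> 0" "q u \<noteq> 0"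
proof -
  have f1_bound: "\<bar>f1 t\<bar> \<le> \<alpha> / r t * \<bar>f t\<bar>" and g1_bound: "\<bar>g1 t\<bar> \<le> \<beta> / r t * \<bar>g t\<bar>" if t: "t \<in> J" for t
  proof -
    have "\<bar>p t\<bar> = \<alpha> * \<bar>f t\<bar>" "\<bar>q t\<bar> = \<beta> * \<bar>g t\<bar>"
      using null[OF t] \<alpha> \<beta> by (metis abs_mult abs_of_pos power2_eq_iff_nonneg power_mult_distrib abs_ge_zero power2_abs)+
    then show "\<bar>f1 t\<bar> \<le> \<alpha> / r t * \<bar>f t\<bar>" "\<bar>g1 t\<bar> \<le> \<beta> / r t * \<bar>g t\<bar>"
      using r_pos[OF t] by (simp_all add: p_def q_def abs_mult field_simps)
  qed
  have c: "continuous_on J (\<lambda>t. \<alpha> / r t)" "continuous_on J (\<lambda>t. \<beta> / r t)"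
    using r_pos by (auto intro!: continuous_intros continuous_rpq simp: less_imp_neq[symmetric])
  show "f u \<noteq> 0"
    using zero_propagates_locally[OF J(1) f f1_bound c(1) u] planar_if_meridian_on_axis not_planar u
    by (metis IntI)
  moreover show "g u \<noteq> 0"
    using zero_propagates_locally[OF J(1) g g1_bound c(2) u] planar_if_meridian_on_axis not_planar u
    by (metis IntI)
  ultimately show "p u \<noteq> 0" "q u \<noteq> 0"
    using null[OF u] \<alpha> \<beta> by auto
qed

text \<open>
  Zero energy gives \<open>f\<^sub>s / f = \<plusminus>\<alpha>\<close> and \<open>g\<^sub>s / g = \<plusminus>\<beta>\<close>. As \<open>f, g, p, q\<close> have no zeros, the signs do not
  change along the meridian, and the logarithmic derivatives are proportional.
\<close>

lemma power_meridian_if_first_integral_zero: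
  assumes null: "\<And>u. u \<in> J \<Longrightarrow> (p u)\<^sup>2 = \<alpha>\<^sup>2 * (f u)\<^sup>2 \<and> (q u)\<^sup>2 = \<beta>\<^sup>2 * (g u)\<^sup>2"
    and not_planar: "\<not> contains_open_part_of_plane J {0..<2 * pi} (rotational_surface \<alpha> \<beta> f g)"
  shows "power_meridian \<alpha> \<beta> f g J"
proof -
  note nz = nonvanishing_if_first_integral_zero[OF null not_planar]
  have "continuous_on J (\<lambda>u. p u * q u * f u * g u)"
    by (intro continuous_intros continuous_meridian continuous_rpq)
  then have "\<exists>s\<in>{-1, 1}. \<forall>u\<in>J. 0 < s * (p u * q u * f u * g u)"
    by (rule nonzero_continuous_sign[OF J(1)]) (use nz in simp)
  then obtain s where s: "s \<in> {-1, 1}" "\<And>u. u \<in> J \<Longrightarrow> 0 < s * (p u * q u * f u * g u)"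
    by blast
  have "\<exists>C. C \<noteq> 0 \<and> (\<forall>u\<in>J. f u = C * \<bar>g u\<bar> powr (s * (\<alpha> / \<beta>)))"
  proof (rule power_relation_of_proportional_log_derivatives[OF J(1) f _ g])
    fix u assume u: "u \<in> J"
    \<comment> \<open>the squares agree because the energy is zero, the signs by the choice of \<open>s\<close>\<close>
    have "\<beta> * p u * g u = s * \<alpha> * q u * f u"
    proof (rule eq_of_square_eq)
      have "s\<^sup>2 = 1" using s(1) by auto
      then show "(\<beta> * p u * g u)\<^sup>2 = (s * \<alpha> * q u * f u)\<^sup>2"
        using null[OF u] by (simp add: power_mult_distrib)
      have "\<beta> * p u * g u * (s * \<alpha> * q u * f u) = \<alpha> * \<beta> * (s * (p u * q u * f u * g u))"
        by simp
      then show "0 < \<beta> * p u * g u * (s * \<alpha> * q u * f u)"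
        using s(2)[OF u] \<alpha> \<beta> by (simp only: mult_pos_pos)
    qed
    then show "f1 u * g u = s * (\<alpha> / \<beta>) * (g1 u * f u)"
      using r_pos[OF u] \<beta> by (simp add: p_def q_def field_simps)
  qed (use nz in auto)
  then show ?thesis
    using s(1) nz(2) unfolding power_meridian_def by auto
qed

text \<open>
  If \<open>A > 0\<close>, then \<open>\<alpha>\<^sup>2 f\<^sup>2 \<ge> A\<close> keeps \<open>f\<close> away from zero, hence \<open>p\<close>, whose derivative is \<open>\<alpha>\<^sup>2 f / r\<close>, is
  strictly monotone. If \<open>A < 0\<close>, then \<open>p\<^sup>2 \<ge> -A\<close> and there is no zero. For \<open>q\<close> the two cases are
  exchanged. So \<open>p\<close> and \<open>q\<close> have at most one zero between them: at most one cut is needed in the radical relation.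
\<close>

lemma finite_turning_points:
  assumes D: "\<And>u. u \<in> J \<Longrightarrow> defect u = 0"
    and A: "\<And>u. u \<in> J \<Longrightarrow> (p u)\<^sup>2 = \<alpha>\<^sup>2 * (f u)\<^sup>2 - A \<and> (q u)\<^sup>2 = \<beta>\<^sup>2 * (g u)\<^sup>2 + A" "A \<noteq> 0"
  shows "finite {u \<in> J. p u = 0}" "finite {u \<in> J. q u = 0}"
proof -
  note iso = isothermal_equations[OF _ D]
  show "finite {u \<in> J. p u = 0}"
  proof (cases "A > 0")
    case True
    have "f u \<noteq> 0" if "u \<in> J" for u
    proof
      assume "f u = 0"
      then have "(p u)\<^sup>2 < 0"
        using A(1)[OF that] True by simp
      then show False by simp
    qed
    then show ?thesis
      using r_pos \<alpha> by (intro at_most_one_zero[OF J(1) iso(1)]) (auto simp: less_imp_neq[symmetric])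
  next
    case False
    then have "{u \<in> J. p u = 0} = {}"
      using A by (smt (verit) Collect_empty_eq mult_nonneg_nonneg zero_le_power2 power_zero_numeral)
    then show ?thesis by (simp only: finite.emptyI)
  qed
  show "finite {u \<in> J. q u = 0}"
  proof (cases "A < 0")
    case True
    have "g u \<noteq> 0" if "u \<in> J" for u
    proof
      assume "g u = 0"
      then have "(q u)\<^sup>2 < 0"
        using A(1)[OF that] True by simp
      then show False by simp
    qed
    then show ?thesis
      using r_pos \<beta> by (intro at_most_one_zero[OF J(1) iso(2)]) (auto simp: less_imp_neq[symmetric])
  next
    case False
    then have "{u \<in> J. q u = 0} = {}"
      using A by (smt (verit) Collect_empty_eq mult_nonneg_nonneg zero_le_power2 power_zero_numeral)
    then show ?thesis by (simp only: finite.emptyI)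
  qed
qed

text \<open>
  Away from turning points the radicals are \<open>\<plusminus>p\<close> and \<open>\<plusminus>q\<close> with fixed signs, and
  \<open>(\<alpha> f \<plusminus> f\<^sub>s)\<^sub>s = \<plusminus>\<alpha> (\<alpha> f \<plusminus> f\<^sub>s)\<close>: each side of the relation is an exponential in the isothermal
  parameter. The sign of the exponent \<open>\<plusminus>\<alpha>/\<beta>\<close> is the product of the two signs.
\<close>

lemma radical_relation_on_piece:
  assumes D: "\<And>u. u \<in> J \<Longrightarrow> defect u = 0"
    and A: "\<And>u. u \<in> J \<Longrightarrow> (p u)\<^sup>2 = \<alpha>\<^sup>2 * (f u)\<^sup>2 - A \<and> (q u)\<^sup>2 = \<beta>\<^sup>2 * (g u)\<^sup>2 + A" "A \<noteq> 0"
    and I: "is_interval I" "I \<subseteq> J" "\<And>u. u \<in> I \<Longrightarrow> p u \<noteq> 0" "\<And>u. u \<in> I \<Longrightarrow> q u \<noteq> 0"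
  shows "\<exists>C. C \<noteq> 0 \<and> (\<exists>k\<in>{\<alpha> / \<beta>, - (\<alpha> / \<beta>)}. \<forall>u\<in>I.
    \<alpha> * f u + sqrt (\<alpha>\<^sup>2 * (f u)\<^sup>2 - A) = C * \<bar>\<beta> * g u + sqrt (\<beta>\<^sup>2 * (g u)\<^sup>2 + A)\<bar> powr k)"
proof -
  have contI: "continuous_on I p" "continuous_on I q"
    using continuous_rpq I(2) continuous_on_subset by blast+
  obtain s where s: "s \<in> {-1, 1}" "\<And>u. u \<in> I \<Longrightarrow> 0 < s * p u"
    using nonzero_continuous_sign[OF I(1) contI(1) I(3)] by blast
  obtain t where t: "t \<in> {-1, 1}" "\<And>u. u \<in> I \<Longrightarrow> 0 < t * q u"
    using nonzero_continuous_sign[OF I(1) contI(2) I(4)] by blast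
  have st: "s * s = 1" "t * t = 1"
    using s(1) t(1) by auto
  have roots: "sqrt (\<alpha>\<^sup>2 * (f u)\<^sup>2 - A) = s * p u" "sqrt (\<beta>\<^sup>2 * (g u)\<^sup>2 + A) = t * q u" if u: "u \<in> I" for u
  proof -
    have "(s * p u)\<^sup>2 = (p u)\<^sup>2" "(t * q u)\<^sup>2 = (q u)\<^sup>2"
      using st by (simp_all add: power_mult_distrib power2_eq_square)
    then show "sqrt (\<alpha>\<^sup>2 * (f u)\<^sup>2 - A) = s * p u" "sqrt (\<beta>\<^sup>2 * (g u)\<^sup>2 + A) = t * q u"
      using A(1)[of u] u I(2) s(2)[OF u] t(2)[OF u] by (auto intro!: real_sqrt_unique)
  qed
  have "\<exists>C. C \<noteq> 0 \<and> (\<forall>u\<in>I. \<alpha> * f u + s * p u = C * \<bar>\<beta> * g u + t * q u\<bar> powr (s * t * (\<alpha> / \<beta>)))"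
  proof (rule power_relation_of_proportional_log_derivatives[OF I(1)])
    fix u assume "u \<in> I"
    then have u: "u \<in> J" using I(2) by blast
    have fgr: "f1 u = p u / r u" "g1 u = q u / r u"
      using r_pos[OF u] by (simp_all add: p_def q_def)
    note sub = DERIV_subset[OF _ I(2)]
    show "((\<lambda>u. \<alpha> * f u + s * p u) has_real_derivative s * \<alpha> / r u * (\<alpha> * f u + s * p u)) (at u within I)"
      by (rule derivative_eq_intros sub[OF f[OF u]] sub[OF isothermal_equations(1)[OF u D[OF u]]] refl)+
        (use st r_pos[OF u] in \<open>simp add: fgr field_simps power2_eq_square\<close>)
    show "((\<lambda>u. \<beta> * g u + t * q u) has_real_derivative t * \<beta> / r u * (\<beta> * g u + t * q u)) (at u within I)"
      by (rule derivative_eq_intros sub[OF g[OF u]] sub[OF isothermal_equations(2)[OF u D[OF u]]] refl)+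
        (use st r_pos[OF u] in \<open>simp add: fgr field_simps power2_eq_square\<close>)
    have "(\<alpha> * f u + s * p u) * (\<alpha> * f u - s * p u) = \<alpha>\<^sup>2 * (f u)\<^sup>2 - (s * s) * (p u)\<^sup>2"
      by (simp add: algebra_simps power2_eq_square)
    then show "\<alpha> * f u + s * p u \<noteq> 0"
      using A(1)[OF u] \<open>A \<noteq> 0\<close> st by auto
    have "(\<beta> * g u + t * q u) * (\<beta> * g u - t * q u) = \<beta>\<^sup>2 * (g u)\<^sup>2 - (t * t) * (q u)\<^sup>2"
      by (simp add: algebra_simps power2_eq_square)
    then show "\<beta> * g u + t * q u \<noteq> 0"
      using A(1)[OF u] \<open>A \<noteq> 0\<close> st by auto
    have "s * t * (\<alpha> / \<beta>) * (t * \<beta> / r u * (\<beta> * g u + t * q u) * (\<alpha> * f u + s * p u))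
      = (t * t) * (s * \<alpha> / r u * (\<alpha> * f u + s * p u) * (\<beta> * g u + t * q u))"
      using \<beta> r_pos[OF u] by (simp add: field_simps)
    also have "\<dots> = s * \<alpha> / r u * (\<alpha> * f u + s * p u) * (\<beta> * g u + t * q u)"
      by (simp only: st mult_1)
    finally show "s * \<alpha> / r u * (\<alpha> * f u + s * p u) * (\<beta> * g u + t * q u) =
      s * t * (\<alpha> / \<beta>) * (t * \<beta> / r u * (\<beta> * g u + t * q u) * (\<alpha> * f u + s * p u))"
      by (rule sym)
  qed
  moreover have "s * t * (\<alpha> / \<beta>) \<in> {\<alpha> / \<beta>, - (\<alpha> / \<beta>)}"
    using s(1) t(1) by auto
  ultimately show ?thesis
    using roots by metis
qed

lemma radical_meridian_if_first_integral_nonzero: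
  assumes D: "\<And>u. u \<in> J \<Longrightarrow> defect u = 0"
    and A: "\<And>u. u \<in> J \<Longrightarrow> (p u)\<^sup>2 = \<alpha>\<^sup>2 * (f u)\<^sup>2 - A \<and> (q u)\<^sup>2 = \<beta>\<^sup>2 * (g u)\<^sup>2 + A" "A \<noteq> 0"
  shows "radical_meridian \<alpha> \<beta> f g J"
proof -
  \<comment> \<open>\<open>p\<^sup>2\<close> and \<open>q\<^sup>2\<close> are the radicands, so the turning points are exactly the singular parameters\<close>
  let ?T = "{u \<in> J. p u = 0} \<union> {u \<in> J. q u = 0}"
  have nonneg: "\<alpha>\<^sup>2 * (f u)\<^sup>2 - A \<ge> 0" "\<beta>\<^sup>2 * (g u)\<^sup>2 + A \<ge> 0" if "u \<in> J" for u
    using A(1)[OF that] by (metis zero_le_power2)+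
  have sing: "?T \<subseteq> {u \<in> J. \<alpha>\<^sup>2 * (f u)\<^sup>2 - A = 0 \<or> \<beta>\<^sup>2 * (g u)\<^sup>2 + A = 0}"
  proof
    fix u assume "u \<in> ?T"
    then show "u \<in> {u \<in> J. \<alpha>\<^sup>2 * (f u)\<^sup>2 - A = 0 \<or> \<beta>\<^sup>2 * (g u)\<^sup>2 + A = 0}"
      using A(1)[of u] by auto
  qed
  have piece: "\<exists>C. C \<noteq> 0 \<and> (\<exists>k\<in>{\<alpha>/\<beta>, -(\<alpha>/\<beta>)}. \<forall>u\<in>I.
             \<alpha>\<^sup>2 * (f u)\<^sup>2 - A \<ge> 0 \<and> \<beta>\<^sup>2 * (g u)\<^sup>2 + A \<ge> 0 \<and>
             \<alpha> * f u + sqrt (\<alpha>\<^sup>2 * (f u)\<^sup>2 - A)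
               = C * \<bar>\<beta> * g u + sqrt (\<beta>\<^sup>2 * (g u)\<^sup>2 + A)\<bar> powr k)"
    if I: "is_interval I" "I \<subseteq> J - ?T" for I
  proof -
    have "I \<subseteq> J" using I by blast
    moreover have "\<exists>C. C \<noteq> 0 \<and> (\<exists>k\<in>{\<alpha> / \<beta>, - (\<alpha> / \<beta>)}. \<forall>u\<in>I.
       \<alpha> * f u + sqrt (\<alpha>\<^sup>2 * (f u)\<^sup>2 - A) = C * \<bar>\<beta> * g u + sqrt (\<beta>\<^sup>2 * (g u)\<^sup>2 + A)\<bar> powr k)"
      using I by (intro radical_relation_on_piece[OF D A]) auto
    ultimately show ?thesis
      using nonneg by (meson subsetD)
  qed
  show ?thesis
    unfolding radical_meridian_def on_pieces_def
    using A(2) finite_turning_points[OF D A] sing piece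
    by (intro exI[of _ A] conjI exI[of _ ?T]) auto
qed

text \<open>
  For \<open>\<alpha> = \<beta>\<close> the two terms of the defect, divided by \<open>E G\<close>, are derivatives of angles: those of the tangent
  and of the position vector of the meridian.
\<close>

lemma arctan_sum_derivative:
  assumes u: "u \<in> J" and S: "S \<subseteq> J" and nz: "g u \<noteq> 0" "g1 u \<noteq> 0" and "\<alpha> = \<beta>"
  shows "((\<lambda>t. arctan (f1 t / g1 t) + arctan (f t / g t)) has_real_derivative defect u / (E u * G u)) (at u within S)"
proof -
  note sub = DERIV_subset[OF _ S]
  define S where "S = (f u)\<^sup>2 + (g u)\<^sup>2"
  have "S > 0"
    using nz(1) by (simp add: S_def sum_power2_gt_zero_iff)
  have G: "G u = \<alpha>\<^sup>2 * S"
    unfolding G_def S_def using \<open>\<alpha> = \<beta>\<close> by (simp add: distrib_left)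
  have eq: "defect u = \<alpha>\<^sup>2 * (S * (f2 u * g1 u - f1 u * g2 u) + E u * (f1 u * g u - f u * g1 u))"
    unfolding defect_def G unfolding \<open>\<alpha> = \<beta>\<close> by (simp add: algebra_simps)
  have "(f2 u * g1 u - f1 u * g2 u) / E u + (f1 u * g u - f u * g1 u) / S = defect u / (E u * G u)"
    unfolding G eq using EG(1)[OF u] \<alpha> \<open>S > 0\<close> by (simp add: field_simps)
  then have "(f2 u * g1 u - f1 u * g2 u) / ((f1 u)\<^sup>2 + (g1 u)\<^sup>2) + (f1 u * g u - f u * g1 u) / ((f u)\<^sup>2 + (g u)\<^sup>2)
      = defect u / (E u * G u)"
    unfolding S_def E_def .
  then show ?thesis
    using DERIV_add[OF arctan_quotient_derivative[OF sub[OF f1[OF u]] sub[OF g1[OF u]] nz(2)]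
        arctan_quotient_derivative[OF sub[OF f[OF u]] sub[OF g[OF u]] nz(1)]] by simp
qed

text \<open>
  Only finiteness of the zeros of \<open>g\<close> and \<open>g'\<close> remains to be seen. If \<open>A = 0\<close>, there are none. If
  \<open>A > 0\<close>, then \<open>q\<^sup>2 \<ge> A\<close>, so \<open>g\<close> is strictly monotone. If \<open>A < 0\<close>, then
  \<open>\<beta>\<^sup>2 g\<^sup>2 \<ge> -A\<close>, so \<open>g\<close> has no zero, and \<open>g'\<close> vanishes only at a turning point.
\<close>

lemma arctan_meridian_if_minimal:
  assumes D: "\<And>u. u \<in> J \<Longrightarrow> defect u = 0" and "\<alpha> = \<beta>"
    and not_planar: "\<not> contains_open_part_of_plane J {0..<2 * pi} (rotational_surface \<alpha> \<beta> f g)"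
  shows "arctan_meridian f g J"
proof -
  obtain A where A: "\<And>u. u \<in> J \<Longrightarrow> (p u)\<^sup>2 = \<alpha>\<^sup>2 * (f u)\<^sup>2 - A \<and> (q u)\<^sup>2 = \<beta>\<^sup>2 * (g u)\<^sup>2 + A"
    using first_integral[OF D] by blast
  have q_zero: "q u = 0 \<longleftrightarrow> g1 u = 0" if "u \<in> J" for u
    using r_pos[OF that] by (simp add: q_def)
  let ?T = "{u \<in> J. g u = 0} \<union> {u \<in> J. g1 u = 0}"
  have "finite {u \<in> J. g u = 0}" "finite {u \<in> J. g1 u = 0}"
  proof -
    consider "A = 0" | "A > 0" | "A < 0" by linarith
    then have "finite {u \<in> J. g u = 0} \<and> finite {u \<in> J. q u = 0}"
    proof cases
      case 1
      then have "\<And>u. u \<in> J \<Longrightarrow> g u \<noteq> 0 \<and> q u \<noteq> 0"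
        using A nonvanishing_if_first_integral_zero[OF _ not_planar] by simp
      then show ?thesis by (simp add: Collect_empty_eq cong: conj_cong)
    next
      case 2
      have "g1 u \<noteq> 0" if "u \<in> J" for u
        using A[OF that] q_zero[OF that] 2 by (smt (verit) mult_nonneg_nonneg zero_le_power2 power_zero_numeral)
      then have "finite {u \<in> J. g u = 0}"
        by (intro at_most_one_zero[OF J(1) g])
      then show ?thesis using finite_turning_points[OF D A] 2 by blast
    next
      case 3
      have "g u \<noteq> 0" if "u \<in> J" for u
      proof
        assume "g u = 0"
        then have "(q u)\<^sup>2 < 0"
          using A[OF that] 3 by simp
        then show False by simp
      qed
      then have "{u \<in> J. g u = 0} = {}" by auto
      then show ?thesis using finite_turning_points[OF D A] 3 by (metis finite.emptyI less_irrefl)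
    qed
    moreover have "{u \<in> J. q u = 0} = {u \<in> J. g1 u = 0}"
      using q_zero by auto
    ultimately show "finite {u \<in> J. g u = 0}" "finite {u \<in> J. g1 u = 0}"
      by simp_all
  qed
  moreover have "\<exists>c. \<forall>u\<in>I. g u \<noteq> 0 \<and> deriv_on J g u \<noteq> 0 \<and>
          arctan (deriv_on J f u / deriv_on J g u) = - arctan (f u / g u) + c"
    if I: "is_interval I" "I \<subseteq> J - ?T" for I
  proof -
    have IJ: "I \<subseteq> J" and nz: "\<And>u. u \<in> I \<Longrightarrow> g u \<noteq> 0" "\<And>u. u \<in> I \<Longrightarrow> g1 u \<noteq> 0"
      using I(2) by auto
    have "\<exists>c. \<forall>u\<in>I. arctan (f1 u / g1 u) + arctan (f u / g u) = c"
    proof (rule has_field_derivative_zero_constant)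
      show "convex I" using I(1) by (simp add: is_interval_convex)
      fix u assume u: "u \<in> I"
      then have "u \<in> J" using IJ by blast
      then show "((\<lambda>u. arctan (f1 u / g1 u) + arctan (f u / g u)) has_real_derivative 0) (at u within I)"
        using arctan_sum_derivative[OF _ IJ nz[OF u] \<open>\<alpha> = \<beta>\<close>] D by simp
    qed
    then obtain c where "\<And>u. u \<in> I \<Longrightarrow> arctan (f1 u / g1 u) + arctan (f u / g u) = c" by blast
    then show ?thesis
      using nz IJ deriv_on_fg by (intro exI[of _ c]) (auto simp: subset_iff algebra_simps)
  qed
  moreover have "?T \<subseteq> {u \<in> J. g u = 0 \<or> deriv_on J g u = 0}"
    using deriv_on_fg by auto
  ultimately show ?thesis
    unfolding arctan_meridian_def on_pieces_def by (intro exI[of _ ?T]) auto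
qed

section \<open>From the meridian to minimality\<close>

lemma defect_zero_if_dense:
  assumes "\<And>U. open U \<Longrightarrow> U \<noteq> {} \<Longrightarrow> U \<subseteq> J \<Longrightarrow> \<exists>u\<in>U. defect u = 0" "u \<in> J"
  shows "defect u = 0"
  using continuous_zero_on_dense[OF J continuous_defect assms] .

text \<open>
  The relation, solved for \<open>A\<close>, is the first integral written without the isothermal
  parameter. The derivative of the difference of its two sides is \<open>-2 f' g' / E\<close> times the defect, so the
  curvature equation can be recovered wherever \<open>f' g' \<noteq> 0\<close>.
\<close>

lemma defect_zero_of_conic_relation:
  assumes "open U" "U \<subseteq> J" "u \<in> U"
    and rel: "\<And>t. t \<in> U \<Longrightarrow> (g1 t)\<^sup>2 * (\<alpha>\<^sup>2 * (f t)\<^sup>2 - A) = (f1 t)\<^sup>2 * (\<beta>\<^sup>2 * (g t)\<^sup>2 + A)"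
    and nz: "f1 u \<noteq> 0" "g1 u \<noteq> 0"
  shows "defect u = 0"
proof -
  note d = interior_deriv[OF assms(1-3)]
  define P where "P = \<alpha>\<^sup>2 * (f u)\<^sup>2 - A"
  define Q where "Q = \<beta>\<^sup>2 * (g u)\<^sup>2 + A"
  define L where "L t = (g1 t)\<^sup>2 * (\<alpha>\<^sup>2 * (f t)\<^sup>2 - A) - (f1 t)\<^sup>2 * (\<beta>\<^sup>2 * (g t)\<^sup>2 + A)" for t
  have "(L has_real_derivative 2 * g1 u * g2 u * P + (g1 u)\<^sup>2 * (2 * \<alpha>\<^sup>2 * f u * f1 u)
      - (2 * f1 u * f2 u * Q + (f1 u)\<^sup>2 * (2 * \<beta>\<^sup>2 * g u * g1 u))) (at u)"
    unfolding L_def P_def Q_def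
    by (rule derivative_eq_intros d refl)+ (simp add: algebra_simps power2_eq_square)
  moreover have "(L has_real_derivative 0) (at u)"
  proof (rule DERIV_cong_ev[OF refl _ refl, THEN iffD1, OF _ DERIV_const[of 0]])
    show "\<forall>\<^sub>F t in nhds u. 0 = L t"
      using eventually_nhds_in_open[OF assms(1,3)] by eventually_elim (simp add: L_def rel)
  qed
  ultimately have 0: "2 * g1 u * g2 u * P + (g1 u)\<^sup>2 * (2 * \<alpha>\<^sup>2 * f u * f1 u)
      - (2 * f1 u * f2 u * Q + (f1 u)\<^sup>2 * (2 * \<beta>\<^sup>2 * g u * g1 u)) = 0"
    using DERIV_unique by blast
  have PQ: "(g1 u)\<^sup>2 * P = (f1 u)\<^sup>2 * Q" "P + Q = G u"
    using rel[OF assms(3)] by (simp_all add: P_def Q_def G_def)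
  have E: "E u * P = (f1 u)\<^sup>2 * G u" "E u * Q = (g1 u)\<^sup>2 * G u"
    unfolding E_def PQ(2)[symmetric] using PQ(1) by (simp_all add: algebra_simps)
  have "2 * f1 u * g1 u * defect u = 
     - (E u * (2 * g1 u * g2 u * P + (g1 u)\<^sup>2 * (2 * \<alpha>\<^sup>2 * f u * f1 u)
      - (2 * f1 u * f2 u * Q + (f1 u)\<^sup>2 * (2 * \<beta>\<^sup>2 * g u * g1 u))))"
    unfolding defect_def using E by algebra
  then show ?thesis
    using nz 0 by simp
qed

lemma defect_zero_if_power_meridian:
  assumes "power_meridian \<alpha> \<beta> f g J" "u \<in> J"
  shows "defect u = 0"
proof (rule defect_zero_if_dense[OF _ \<open>u \<in> J\<close>])
  obtain c k where c: "c \<noteq> 0" and k: "k \<in> {- (\<alpha> / \<beta>), \<alpha> / \<beta>}"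
    and rel: "\<And>u. u \<in> J \<Longrightarrow> g u \<noteq> 0 \<and> f u = c * \<bar>g u\<bar> powr k"
    using assms(1) unfolding power_meridian_def by blast
  have k2: "k\<^sup>2 * \<beta>\<^sup>2 = \<alpha>\<^sup>2" "k \<noteq> 0"
    using k \<alpha> \<beta> by (auto simp: power_divide)
  fix U assume U: "open U" "U \<noteq> {}" "U \<subseteq> J"
  then obtain u where u: "u \<in> U" by blast
  have log: "f1 t * g t = k * (g1 t * f t)" if t: "t \<in> U" for t
    using proportional_log_derivatives_of_power_relation[OF U(1) t interior_deriv(1,2)[OF U(1,3) t]] rel U(3) t
    by blast
  have nz: "f t \<noteq> 0" "g t \<noteq> 0" if "t \<in> U" for t
    using rel[of t] c U(3) that by auto
  have "defect u = 0"
  proof (rule defect_zero_of_conic_relation[OF U(1,3) u, of 0])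
    fix t assume t: "t \<in> U"
    have "(f1 t)\<^sup>2 * (g t)\<^sup>2 = k\<^sup>2 * ((g1 t)\<^sup>2 * (f t)\<^sup>2)"
      using log[OF t] by (metis power_mult_distrib)
    then have "\<beta>\<^sup>2 * ((f1 t)\<^sup>2 * (g t)\<^sup>2) = (k\<^sup>2 * \<beta>\<^sup>2) * ((g1 t)\<^sup>2 * (f t)\<^sup>2)"
      by simp
    then show "(g1 t)\<^sup>2 * (\<alpha>\<^sup>2 * (f t)\<^sup>2 - 0) = (f1 t)\<^sup>2 * (\<beta>\<^sup>2 * (g t)\<^sup>2 + 0)"
      unfolding k2 by (simp add: algebra_simps)
  next
    have "u \<in> J" using u U(3) by blast
    then show "f1 u \<noteq> 0" "g1 u \<noteq> 0"
      using log[OF u] nz[OF u] k2(2) E_pos[of u] by auto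
  qed
  then show "\<exists>u\<in>U. defect u = 0" using u by blast
qed

text \<open>
  The radicands \<open>P\<close> and \<open>Q\<close> could a priori vanish on whole intervals. Every open set contains an open
  \<open>W\<close> on which each of them is identically zero or nowhere zero. There the logarithmic derivatives
  of both sides exist, and comparing them gives \<open>x\<^sup>2 = y\<^sup>2\<close> for \<open>x = f' / \<surd>P\<close> and \<open>y = g' / \<surd>Q\<close>.
  Regularity of the meridian excludes \<open>x = 0\<close>, and with it the degenerate alternative.
\<close>

lemma defect_zero_if_radical_meridian:
  assumes "radical_meridian \<alpha> \<beta> f g J" "u \<in> J"
  shows "defect u = 0"
proof (rule defect_zero_if_dense[OF _ \<open>u \<in> J\<close>])
  fix U assume U: "open U" "U \<noteq> {}" "U \<subseteq> J"
  obtain A where A: "A \<noteq> 0" and pieces: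
    "on_pieces J {u \<in> J. \<alpha>\<^sup>2 * (f u)\<^sup>2 - A = 0 \<or> \<beta>\<^sup>2 * (g u)\<^sup>2 + A = 0}
          (\<lambda>I. \<exists>C. C \<noteq> 0 \<and> (\<exists>k\<in>{\<alpha>/\<beta>, -(\<alpha>/\<beta>)}. \<forall>u\<in>I.
             \<alpha>\<^sup>2 * (f u)\<^sup>2 - A \<ge> 0 \<and> \<beta>\<^sup>2 * (g u)\<^sup>2 + A \<ge> 0 \<and>
             \<alpha> * f u + sqrt (\<alpha>\<^sup>2 * (f u)\<^sup>2 - A)
               = C * \<bar>\<beta> * g u + sqrt (\<beta>\<^sup>2 * (g u)\<^sup>2 + A)\<bar> powr k))"
    using assms(1) unfolding radical_meridian_def by blast
  define P where "P t = \<alpha>\<^sup>2 * (f t)\<^sup>2 - A" for t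
  define Q where "Q t = \<beta>\<^sup>2 * (g t)\<^sup>2 - (- A)" for t
  have Q: "\<beta>\<^sup>2 * (g t)\<^sup>2 + A = Q t" for t
    by (simp add: Q_def)
  obtain I where "I \<subseteq> U \<and> open I \<and> I \<noteq> {} \<and>
    (\<exists>C. C \<noteq> 0 \<and> (\<exists>k\<in>{\<alpha>/\<beta>, -(\<alpha>/\<beta>)}. \<forall>t\<in>I. P t \<ge> 0 \<and> Q t \<ge> 0 \<and>
      \<alpha> * f t + sqrt (P t) = C * \<bar>\<beta> * g t + sqrt (Q t)\<bar> powr k))"
    using on_pieces_open[OF pieces U, folded P_def, unfolded Q] ..
  then obtain C k where I: "I \<subseteq> U" "open I" "I \<noteq> {}" and C: "C \<noteq> 0" and k: "k \<in> {\<alpha>/\<beta>, -(\<alpha>/\<beta>)}"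
    and rel: "\<And>t. t \<in> I \<Longrightarrow> P t \<ge> 0 \<and> Q t \<ge> 0 \<and>
      \<alpha> * f t + sqrt (P t) = C * \<bar>\<beta> * g t + sqrt (Q t)\<bar> powr k"
    by blast
  have k2: "k\<^sup>2 * \<beta>\<^sup>2 = \<alpha>\<^sup>2"
    using k \<beta> by (auto simp: power_divide)
  have cont: "continuous_on J P" "continuous_on J Q"
    unfolding P_def Q_def by (intro continuous_intros continuous_meridian)+
  obtain W1 where W1: "W1 \<subseteq> I" "open W1" "W1 \<noteq> {}" "(\<forall>t\<in>W1. P t = 0) \<or> (\<forall>t\<in>W1. P t \<noteq> 0)"
    using open_zero_dichotomy[OF I(2,3) continuous_on_subset[OF cont(1)]] I(1) U(3) by blast
  obtain W where W: "W \<subseteq> W1" "open W" "W \<noteq> {}" "(\<forall>t\<in>W. Q t = 0) \<or> (\<forall>t\<in>W. Q t \<noteq> 0)"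
    using open_zero_dichotomy[OF W1(2,3) continuous_on_subset[OF cont(2)]] W1(1) I(1) U(3) by blast
  have WJ: "W \<subseteq> J" and WI: "W \<subseteq> I"
    using W(1) W1(1) I(1) U(3) by blast+
  have dich: "(\<forall>t\<in>W. P t = 0) \<or> (\<forall>t\<in>W. P t \<noteq> 0)"
    using W1(4) W(1) by blast
  have A': "- A \<noteq> 0"
    using A by simp
  have key: "(f1 t)\<^sup>2 * Q t = (g1 t)\<^sup>2 * P t \<and> f1 t \<noteq> 0 \<and> g1 t \<noteq> 0" if t: "t \<in> W" for t
  proof -
    note d = interior_deriv[OF W(2) WJ t]
    have tI: "t \<in> I" and tJ: "t \<in> J" using t WI WJ by auto
    define x where "x = f1 t / sqrt (P t)"
    define y where "y = g1 t / sqrt (Q t)"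
    let ?F = "\<lambda>t. \<alpha> * f t + sqrt (P t)" and ?G = "\<lambda>t. \<beta> * g t + sqrt (Q t)"
    have F: "(?F has_real_derivative \<alpha> * x * ?F t) (at t)" "f1 t = x * sqrt (P t)"
      using radical_base_derivative[OF W(2) t d(1) \<alpha> A] rel WI dich unfolding P_def x_def by blast+
    have G: "(?G has_real_derivative \<beta> * y * ?G t) (at t)" "g1 t = y * sqrt (Q t)"
      using radical_base_derivative[OF W(2) t d(2) \<beta> A'] rel WI W(4) unfolding Q_def y_def by blast+
    have PQ: "(sqrt (P t))\<^sup>2 = P t" "(sqrt (Q t))\<^sup>2 = Q t"
      using rel[OF tI] by simp_all
    have Gnz: "?G t \<noteq> 0"
    proof
      assume "?G t = 0"
      then have "(\<beta> * g t)\<^sup>2 = (sqrt (Q t))\<^sup>2" by (simp add: power2_eq_iff add_eq_0_iff)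
      then show False using A unfolding PQ by (simp add: Q_def power_mult_distrib)
    qed
    have Fnz: "?F t \<noteq> 0"
      using rel[OF tI] C Gnz by simp
    have "\<alpha> * x * ?F t * ?G t = k * (\<beta> * y * ?G t * ?F t)"
      using proportional_log_derivatives_of_power_relation[OF W(2) t F(1) G(1) Gnz] rel WI by blast
    then have "\<alpha> * x = k * \<beta> * y"
      using Fnz Gnz by simp
    then have "\<alpha>\<^sup>2 * x\<^sup>2 = \<alpha>\<^sup>2 * y\<^sup>2"
      unfolding k2[symmetric] by (metis power_mult_distrib k2)
    then have xy: "x\<^sup>2 = y\<^sup>2" using \<alpha> by simp
    have sq: "(f1 t)\<^sup>2 = x\<^sup>2 * P t" "(g1 t)\<^sup>2 = x\<^sup>2 * Q t"
      using F(2) G(2) PQ xy by (metis power_mult_distrib)+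
    \<comment> \<open>\<open>x = 0\<close> would make \<open>f'\<close> and \<open>g'\<close> vanish together; and \<open>x \<noteq> 0\<close> rules out a zero numerator and a zero radical\<close>
    have "x \<noteq> 0"
      using E_pos[OF tJ] sq by auto
    moreover from this have "y \<noteq> 0" using xy by auto
    ultimately have "f1 t \<noteq> 0" "g1 t \<noteq> 0"
      by (auto simp: x_def y_def)
    then show ?thesis
      using sq by simp
  qed
  obtain w where w: "w \<in> W" using W(3) by blast
  have "defect w = 0"
    using key[OF w] key
    by (intro defect_zero_of_conic_relation[OF W(2) WJ w, of A]) (auto simp: P_def Q_def)
  then show "\<exists>u\<in>U. defect u = 0"
    using w WI I(1) by blast
qed

lemma defect_zero_if_arctan_meridian:
  assumes "arctan_meridian f g J" "\<alpha> = \<beta>" "u \<in> J"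
  shows "defect u = 0"
proof (rule defect_zero_if_dense[OF _ \<open>u \<in> J\<close>])
  fix U assume U: "open U" "U \<noteq> {}" "U \<subseteq> J"
  obtain I c where I: "I \<subseteq> U" "open I" "I \<noteq> {}"
    and rel: "\<And>t. t \<in> I \<Longrightarrow> g t \<noteq> 0 \<and> deriv_on J g t \<noteq> 0 \<and>
      arctan (deriv_on J f t / deriv_on J g t) = - arctan (f t / g t) + c"
    using on_pieces_open[OF assms(1)[unfolded arctan_meridian_def] U] by blast
  then obtain t where t: "t \<in> I" by blast
  have IJ: "I \<subseteq> J" using I(1) U(3) by blast
  then have tJ: "t \<in> J" using t by blast
  have nz: "g t \<noteq> 0" "g1 t \<noteq> 0"
    using rel[OF t] deriv_on_fg[OF tJ] by auto
  let ?S = "\<lambda>t. arctan (f1 t / g1 t) + arctan (f t / g t)"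
  have "(?S has_real_derivative defect t / (E t * G t)) (at t)"
    using arctan_sum_derivative[OF tJ IJ nz assms(2)] at_within_open[OF t I(2)] by simp
  moreover have "(?S has_real_derivative 0) (at t)"
  proof (rule DERIV_cong_ev[OF refl _ refl, THEN iffD1, OF _ DERIV_const[of c]])
    show "\<forall>\<^sub>F s in nhds t. c = ?S s"
      using eventually_nhds_in_open[OF I(2) t]
    proof eventually_elim
      case (elim s)
      then show ?case using rel[OF elim] deriv_on_fg IJ by (auto simp: subset_iff)
    qed
  qed
  ultimately have "defect t / (E t * G t) = 0"
    using DERIV_unique by blast
  then have "defect t = 0"
    using EG[OF tJ] by simp
  then show "\<exists>u\<in>U. defect u = 0"
    using t I(1) by blast
qed

section \<open>The classification\<close>

theorem minimal_iff_meridian: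
  assumes not_planar: "\<not> contains_open_part_of_plane J {0..<2 * pi} (rotational_surface \<alpha> \<beta> f g)"
  shows "minimal_surface J {0..<2 * pi} (rotational_surface \<alpha> \<beta> f g) \<longleftrightarrow>
     (\<alpha> \<noteq> \<beta> \<and> power_meridian \<alpha> \<beta> f g J) \<or>
     (\<alpha> \<noteq> \<beta> \<and> radical_meridian \<alpha> \<beta> f g J) \<or>
     (\<alpha> = \<beta> \<and> arctan_meridian f g J)"
  unfolding minimal_iff_defect_zero
proof
  assume D: "\<forall>u\<in>J. defect u = 0"
  obtain A where A: "\<And>u. u \<in> J \<Longrightarrow> (p u)\<^sup>2 = \<alpha>\<^sup>2 * (f u)\<^sup>2 - A \<and> (q u)\<^sup>2 = \<beta>\<^sup>2 * (g u)\<^sup>2 + A"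
    using first_integral D by blast
  have "power_meridian \<alpha> \<beta> f g J" if "A = 0"
    using power_meridian_if_first_integral_zero[OF _ not_planar] A that by simp
  moreover have "radical_meridian \<alpha> \<beta> f g J" if "A \<noteq> 0"
    using radical_meridian_if_first_integral_nonzero[OF _ A that] D by blast
  moreover have "arctan_meridian f g J" if "\<alpha> = \<beta>"
    using arctan_meridian_if_minimal[OF _ that not_planar] D by blast
  ultimately show "(\<alpha> \<noteq> \<beta> \<and> power_meridian \<alpha> \<beta> f g J) \<or> (\<alpha> \<noteq> \<beta> \<and> radical_meridian \<alpha> \<beta> f g J) \<or>
     (\<alpha> = \<beta> \<and> arctan_meridian f g J)"
    by blast
next
  assume "(\<alpha> \<noteq> \<beta> \<and> power_meridian \<alpha> \<beta> f g J) \<or> (\<alpha> \<noteq> \<beta> \<and> radical_meridian \<alpha> \<beta> f g J) \<or>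
     (\<alpha> = \<beta> \<and> arctan_meridian f g J)"
  then show "\<forall>u\<in>J. defect u = 0"
    using defect_zero_if_power_meridian defect_zero_if_radical_meridian defect_zero_if_arctan_meridian
    by blast
qed

end

theorem theorem4p2:
  fixes \<alpha> \<beta> :: real and f g :: "real \<Rightarrow> real" and J :: "real set"
  assumes "is_interval J" and "interior J \<noteq> {}"
    and "\<alpha> > 0" and "\<beta> > 0"
    and "smooth_on J f" and "smooth_on J g"
    and "\<And>u. u \<in> J \<Longrightarrow> \<alpha>\<^sup>2 * (f u)\<^sup>2 + \<beta>\<^sup>2 * (g u)\<^sup>2 > 0"
    and "\<And>u. u \<in> J \<Longrightarrow> (deriv_on J f u)\<^sup>2 + (deriv_on J g u)\<^sup>2 > 0"
    and "\<not> contains_open_part_of_plane J {0..<2 * pi} (rotational_surface \<alpha> \<beta> f g)"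
  shows "minimal_surface J {0..<2 * pi} (rotational_surface \<alpha> \<beta> f g) \<longleftrightarrow>
     (\<alpha> \<noteq> \<beta> \<and> power_meridian \<alpha> \<beta> f g J) \<or>
     (\<alpha> \<noteq> \<beta> \<and> radical_meridian \<alpha> \<beta> f g J) \<or>
     (\<alpha> = \<beta> \<and> arctan_meridian f g J)"
proof -
  have smooth: "smooth_on J (deriv_on J h) \<and> (\<forall>u\<in>J. (h has_real_derivative deriv_on J h u) (at u within J))"
    if "smooth_on J h" for h :: "real \<Rightarrow> real"
    using smooth_on_deriv[OF that assms(1,2)] assms(2) interior_subset by blast
  have f2: "continuous_on J (deriv_on J (deriv_on J f))" and g2: "continuous_on J (deriv_on J (deriv_on J g))"
    using smooth assms(5,6) by (meson DERIV_continuous_on)+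
  interpret rotational_meridian \<alpha> \<beta> f g "deriv_on J f" "deriv_on J g"
      "deriv_on J (deriv_on J f)" "deriv_on J (deriv_on J g)" J
    using assms smooth f2 g2 by unfold_locales blast+
  show ?thesis
    by (rule minimal_iff_meridian[OF assms(9)])
qed

end
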